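(* Let $1\le p<\infty$, let $\mathcal{T}:\mathscr{D}(\mathcal{T})\subset X_p\to X_p$ be a densely defined unbounded operator with $s(\mathcal{T})<0$ and $(0-\mathcal{T})^{-1}(X_p^+)\subset X_p^+$, and let $\mathcal{K}_s,\mathcal{K}_f$ be two nonnegative bounded operators in $X_p$; set $\mathcal{K}=\mathcal{K}_s+\mathcal{K}_f$ and $\mathcal{K}(\gamma)=\mathcal{K}_s+\frac1\gamma\mathcal{K}_f$ for $\gamma>0$. Assume that $(0-\mathcal{T})^{-1}\mathcal{K}$ is power-compact, that $(0-\mathcal{T})^{-1}\mathcal{K}_f$ is irreducible, and that $$\lim_{\gamma\to0}r_\sigma[(0-\mathcal{T})^{-1}\mathcal{K}(\gamma)]>1\quad\text{and}\quad r_\sigma[(0-\mathcal{T})^{-1}\mathcal{K}_s]<1 .$$ If $\mathcal{K}_f(X_p^+)\subset X_p^+$, then the criticality eigenvalue $k_{\mathrm{eff}}$ is characterized by $$\frac{1}{k_{\mathrm{eff}}}=\min_{\varphi\in W_p^+}\ \operatorname*{ess\,sup}_{\omega\in\mathbf{\Omega}}\frac{-(\mathcal{T}+\mathcal{K}_s)\varphi(\omega)}{\mathcal{K}_f\varphi(\omega)}=\max_{\varphi\in W_p^+}\ \operatorname*{ess\,inf}_{\omega\in\mathbf{\Omega}}\frac{-(\mathcal{T}+\mathcal{K}_s)\varphi(\omega)}{\mathcal{K}_f\varphi(\omega)} .$$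
   Context: $(\mathbf{\Omega},\nu)$ is a measure space, $X_p=L^p(\mathbf{\Omega},d\nu)$, whose dual space is identified with $X_q=L^q(\mathbf{\Omega},d\nu)$, $1/p+1/q=1$, with duality pairing $\langle\cdot,\cdot\rangle$. $X_p^+=\{f\in X_p: f(\omega)>0 \text{ for } \nu\text{-a.e. }\omega\in\mathbf{\Omega}\}$, and $W_p^+=\mathscr{D}(\mathcal{T})\cap X_p^+$. $s(\mathcal{T})$ is the spectral bound (supremum of real parts of the spectrum) of $\mathcal{T}$; $r_\sigma[B]$ is the spectral radius of a bounded operator $B$. A bounded operator is nonnegative if it maps nonnegative functions to nonnegative functions. A bounded operator $B$ in $X_p$ is irreducible if for every nonnegative $\varphi\in X_p\setminus\{0\}$ and nonnegative $\psi\in X_q\setminus\{0\}$ there is $n\in\mathbb{N}$ with $\langle B^n\varphi,\psi\rangle>0$. $B$ is power-compact if $B^n$ is compact for some $n\in\mathbb{N}$. Under the stated assumptions it is known that there is a unique $k_{\mathrm{eff}}>0$ for which there exists a nonnegative $\phi_{\mathrm{eff}}\in\mathscr{D}(\mathcal{T})\setminus\{0\}$ with $(\mathcal{T}+\mathcal{K}_s+\frac{1}{k_{\mathrm{eff}}}\mathcal{K}_f)\phi_{\mathrm{eff}}=0$; this number is the criticality eigenvalue. Essential suprema and infima are taken with respect to $\nu$.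
   Formalization: The measure space is assumed sigma-finite; otherwise X_p^+ is empty, so the min and max do not exist (e.g. two atoms of mass 1 and infinity, p=2, T=-1, K_s=0, K_f=2). *)

theory Defs
  imports "HOL-Probability.Essential_Supremum" "HOL-Library.Complex_Order"
begin

text \<open>
  Elements of \<open>L\<^sup>p\<close> are represented by measurable functions, identified when they agree almost
  everywhere: all operators below are required to respect this identification, and all equations
  and inequalities between functions hold almost everywhere. Scalars are complex, as spectra are
  considered. The order on \<^typ>\<open>complex\<close> is that of \<^theory>\<open>HOL-Library.Complex_Order\<close>: \<open>0 \<le> z\<close>
  means that \<open>z\<close> is real and nonnegative, and \<open>0 < z\<close> that it is real and positive.
\<close>

definition ae_eq :: "'a measure \<Rightarrow> ('a \<Rightarrow> complex) \<Rightarrow> ('a \<Rightarrow> complex) \<Rightarrow> bool"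
  where "ae_eq M f g \<longleftrightarrow> (AE x in M. f x = g x)"

definition Lp :: "'a measure \<Rightarrow> real \<Rightarrow> ('a \<Rightarrow> complex) set"
  where "Lp M p = {f \<in> borel_measurable M. integrable M (\<lambda>x. norm (f x) powr p)}"

definition Lp_norm :: "'a measure \<Rightarrow> real \<Rightarrow> ('a \<Rightarrow> complex) \<Rightarrow> real"
  where "Lp_norm M p f = (LINT x|M. norm (f x) powr p) powr (1 / p)"

definition Linf :: "'a measure \<Rightarrow> ('a \<Rightarrow> complex) set"
  where "Linf M = {f \<in> borel_measurable M. esssup M (\<lambda>x. ereal (norm (f x))) < \<infinity>}"

text \<open>\<open>L\<^sup>q\<close> for the exponent \<open>q\<close> conjugate to \<open>p\<close>.\<close>

definition dual_Lp :: "'a measure \<Rightarrow> real \<Rightarrow> ('a \<Rightarrow> complex) set"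
  where "dual_Lp M p = (if p = 1 then Linf M else Lp M (p / (p - 1)))"

definition pairing :: "'a measure \<Rightarrow> ('a \<Rightarrow> complex) \<Rightarrow> ('a \<Rightarrow> complex) \<Rightarrow> complex"
  where "pairing M f g = (LINT x|M. f x * g x)"

definition nonneg :: "'a measure \<Rightarrow> ('a \<Rightarrow> complex) \<Rightarrow> bool"
  where "nonneg M f \<longleftrightarrow> (AE x in M. 0 \<le> f x)"

definition Lp_pos :: "'a measure \<Rightarrow> real \<Rightarrow> ('a \<Rightarrow> complex) set"
  where "Lp_pos M p = {f \<in> Lp M p. AE x in M. 0 < f x}"

text \<open>A linear operator in \<open>L\<^sup>p\<close> with domain \<open>D\<close>; the values of \<open>T\<close> outside \<open>D\<close> are irrelevant.\<close>

definition linear_op ::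
  "'a measure \<Rightarrow> real \<Rightarrow> ('a \<Rightarrow> complex) set \<Rightarrow> (('a \<Rightarrow> complex) \<Rightarrow> ('a \<Rightarrow> complex)) \<Rightarrow> bool"
  where "linear_op M p D T \<longleftrightarrow>
    D \<subseteq> Lp M p \<and>
    (\<forall>f\<in>D. \<forall>g\<in>Lp M p. ae_eq M f g \<longrightarrow> g \<in> D) \<and>
    (\<lambda>x. 0) \<in> D \<and>
    (\<forall>f\<in>D. \<forall>g\<in>D. (\<lambda>x. f x + g x) \<in> D) \<and>
    (\<forall>c. \<forall>f\<in>D. (\<lambda>x. c * f x) \<in> D) \<and>
    (\<forall>f\<in>D. T f \<in> Lp M p) \<and>
    (\<forall>f\<in>D. \<forall>g\<in>D. ae_eq M f g \<longrightarrow> ae_eq M (T f) (T g)) \<and>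
    (\<forall>f\<in>D. \<forall>g\<in>D. ae_eq M (T (\<lambda>x. f x + g x)) (\<lambda>x. T f x + T g x)) \<and>
    (\<forall>c. \<forall>f\<in>D. ae_eq M (T (\<lambda>x. c * f x)) (\<lambda>x. c * T f x))"

definition densely_defined :: "'a measure \<Rightarrow> real \<Rightarrow> ('a \<Rightarrow> complex) set \<Rightarrow> bool"
  where "densely_defined M p D \<longleftrightarrow>
    (\<forall>f\<in>Lp M p. \<forall>e>0. \<exists>g\<in>D. Lp_norm M p (\<lambda>x. f x - g x) < e)"

definition bounded_op ::
  "'a measure \<Rightarrow> real \<Rightarrow> (('a \<Rightarrow> complex) \<Rightarrow> ('a \<Rightarrow> complex)) \<Rightarrow> bool"
  where "bounded_op M p B \<longleftrightarrow>
    linear_op M p (Lp M p) B \<and> (\<exists>C. \<forall>f\<in>Lp M p. Lp_norm M p (B f) \<le> C * Lp_norm M p f)"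

definition nonneg_op ::
  "'a measure \<Rightarrow> real \<Rightarrow> (('a \<Rightarrow> complex) \<Rightarrow> ('a \<Rightarrow> complex)) \<Rightarrow> bool"
  where "nonneg_op M p B \<longleftrightarrow> (\<forall>f\<in>Lp M p. nonneg M f \<longrightarrow> nonneg M (B f))"

text \<open>\<open>R\<close> is a bounded two-sided inverse of \<open>z - T : D \<rightarrow> L\<^sup>p\<close>.\<close>

definition is_resolvent ::
  "'a measure \<Rightarrow> real \<Rightarrow> ('a \<Rightarrow> complex) set \<Rightarrow> (('a \<Rightarrow> complex) \<Rightarrow> ('a \<Rightarrow> complex)) \<Rightarrow>
   complex \<Rightarrow> (('a \<Rightarrow> complex) \<Rightarrow> ('a \<Rightarrow> complex)) \<Rightarrow> bool"
  where "is_resolvent M p D T z R \<longleftrightarrow>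
    bounded_op M p R \<and>
    (\<forall>f\<in>Lp M p. R f \<in> D \<and> ae_eq M (\<lambda>x. z * R f x - T (R f) x) f) \<and>
    (\<forall>f\<in>D. ae_eq M (R (\<lambda>x. z * f x - T f x)) f)"

definition op_spectrum ::
  "'a measure \<Rightarrow> real \<Rightarrow> ('a \<Rightarrow> complex) set \<Rightarrow> (('a \<Rightarrow> complex) \<Rightarrow> ('a \<Rightarrow> complex)) \<Rightarrow> complex set"
  where "op_spectrum M p D T = {z. \<nexists>R. is_resolvent M p D T z R}"

text \<open>\<open>(z - T)\<^sup>-\<^sup>1\<close>, determined up to equality almost everywhere for \<open>z\<close> outside the spectrum.\<close>

definition resolvent ::
  "'a measure \<Rightarrow> real \<Rightarrow> ('a \<Rightarrow> complex) set \<Rightarrow> (('a \<Rightarrow> complex) \<Rightarrow> ('a \<Rightarrow> complex)) \<Rightarrow>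
   complex \<Rightarrow> (('a \<Rightarrow> complex) \<Rightarrow> ('a \<Rightarrow> complex))"
  where "resolvent M p D T z = (SOME R. is_resolvent M p D T z R)"

text \<open>Extended values: an unbounded operator may have empty spectrum, with spectral bound \<open>-\<infinity>\<close>.\<close>

definition spectral_bound ::
  "'a measure \<Rightarrow> real \<Rightarrow> ('a \<Rightarrow> complex) set \<Rightarrow> (('a \<Rightarrow> complex) \<Rightarrow> ('a \<Rightarrow> complex)) \<Rightarrow> ereal"
  where "spectral_bound M p D T = (SUP z\<in>op_spectrum M p D T. ereal (Re z))"

definition spectral_radius ::
  "'a measure \<Rightarrow> real \<Rightarrow> (('a \<Rightarrow> complex) \<Rightarrow> ('a \<Rightarrow> complex)) \<Rightarrow> ennreal"
  where "spectral_radius M p B = (SUP z\<in>op_spectrum M p (Lp M p) B. ennreal (cmod z))"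

definition compact_op ::
  "'a measure \<Rightarrow> real \<Rightarrow> (('a \<Rightarrow> complex) \<Rightarrow> ('a \<Rightarrow> complex)) \<Rightarrow> bool"
  where "compact_op M p B \<longleftrightarrow>
    linear_op M p (Lp M p) B \<and>
    (\<forall>f. (\<forall>n::nat. f n \<in> Lp M p) \<and> (\<exists>C. \<forall>n. Lp_norm M p (f n) \<le> C) \<longrightarrow>
      (\<exists>r g. strict_mono r \<and> g \<in> Lp M p \<and>
        (\<lambda>n. Lp_norm M p (\<lambda>x. B (f (r n)) x - g x)) \<longlonglongrightarrow> 0))"

definition power_compact ::
  "'a measure \<Rightarrow> real \<Rightarrow> (('a \<Rightarrow> complex) \<Rightarrow> ('a \<Rightarrow> complex)) \<Rightarrow> bool"
  where "power_compact M p B \<longleftrightarrow> (\<exists>n\<ge>1. compact_op M p (B ^^ n))"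

definition irreducible_op ::
  "'a measure \<Rightarrow> real \<Rightarrow> (('a \<Rightarrow> complex) \<Rightarrow> ('a \<Rightarrow> complex)) \<Rightarrow> bool"
  where "irreducible_op M p B \<longleftrightarrow>
    (\<forall>f\<in>Lp M p. \<forall>g\<in>dual_Lp M p.
      nonneg M f \<and> \<not> ae_eq M f (\<lambda>x. 0) \<and> nonneg M g \<and> \<not> ae_eq M g (\<lambda>x. 0) \<longrightarrow>
      (\<exists>n\<ge>1. 0 < pairing M ((B ^^ n) f) g))"

definition K_gamma ::
  "(('a \<Rightarrow> complex) \<Rightarrow> ('a \<Rightarrow> complex)) \<Rightarrow> (('a \<Rightarrow> complex) \<Rightarrow> ('a \<Rightarrow> complex)) \<Rightarrow>
   real \<Rightarrow> (('a \<Rightarrow> complex) \<Rightarrow> ('a \<Rightarrow> complex))"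
  where "K_gamma Ks Kf \<gamma> f = (\<lambda>x. Ks f x + complex_of_real (1 / \<gamma>) * Kf f x)"

text \<open>The defining property of the number \<open>k\<^sub>e\<^sub>f\<^sub>f\<close>; uniqueness is not part of it.\<close>

definition criticality_eigenvalue ::
  "'a measure \<Rightarrow> ('a \<Rightarrow> complex) set \<Rightarrow> (('a \<Rightarrow> complex) \<Rightarrow> ('a \<Rightarrow> complex)) \<Rightarrow>
   (('a \<Rightarrow> complex) \<Rightarrow> ('a \<Rightarrow> complex)) \<Rightarrow> (('a \<Rightarrow> complex) \<Rightarrow> ('a \<Rightarrow> complex)) \<Rightarrow> real \<Rightarrow> bool"
  where "criticality_eigenvalue M D T Ks Kf k \<longleftrightarrow>
    0 < k \<and>
    (\<exists>f\<in>D. nonneg M f \<and> \<not> ae_eq M f (\<lambda>x. 0) \<and>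
      ae_eq M (\<lambda>x. T f x + Ks f x + complex_of_real (1 / k) * Kf f x) (\<lambda>x. 0))"

definition essinf :: "'a measure \<Rightarrow> ('a \<Rightarrow> ereal) \<Rightarrow> ereal"
  where "essinf M f = - esssup M (\<lambda>x. - f x)"

text \<open>
  In the situation of interest \<open>T f\<close>, \<open>Ks f\<close> and \<open>Kf f\<close> are real almost everywhere for positive \<open>f\<close>
  in the domain of \<open>T\<close> (and \<open>Kf f\<close> is positive), so that \<^const>\<open>Re\<close> only changes the type of the
  quotient.
\<close>

definition criticality_quotient ::
  "(('a \<Rightarrow> complex) \<Rightarrow> ('a \<Rightarrow> complex)) \<Rightarrow> (('a \<Rightarrow> complex) \<Rightarrow> ('a \<Rightarrow> complex)) \<Rightarrow>
   (('a \<Rightarrow> complex) \<Rightarrow> ('a \<Rightarrow> complex)) \<Rightarrow> ('a \<Rightarrow> complex) \<Rightarrow> 'a \<Rightarrow> ereal"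
  where "criticality_quotient T Ks Kf f x = ereal (Re (- (T f x + Ks f x) / Kf f x))"

definition is_min_over :: "'b set \<Rightarrow> ('b \<Rightarrow> ereal) \<Rightarrow> ereal \<Rightarrow> bool"
  where "is_min_over W F m \<longleftrightarrow> m \<in> F ` W \<and> (\<forall>f\<in>W. m \<le> F f)"

definition is_max_over :: "'b set \<Rightarrow> ('b \<Rightarrow> ereal) \<Rightarrow> ereal \<Rightarrow> bool"
  where "is_max_over W F m \<longleftrightarrow> m \<in> F ` W \<and> (\<forall>f\<in>W. F f \<le> m)"

end

theory Submission
  imports Defs
begin

text \<open>
  Write \<open>R = (0 - T)\<^sup>-\<^sup>1\<close> and \<open>B\<^sub>\<mu> = R (Ks + \<mu> Kf)\<close>. Applying the positive operator \<open>R\<close> turns the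
  inequality \<open>- (T + Ks) f \<le> \<mu> Kf f\<close> into \<open>f \<le> B\<^sub>\<mu> f\<close>, and the opposite one into \<open>B\<^sub>\<mu> f \<le> f\<close>. So a
  positive \<open>f\<close> whose quotient has essential supremum at most \<open>\<mu>\<close> is a subsolution for \<open>B\<^sub>\<mu>\<close>, and one
  whose quotient has essential infimum at least \<open>\<nu>\<close> is a supersolution for \<open>B\<^sub>\<nu>\<close>. Everything rests
  on one comparison (\<open>sub_super_comparison\<close>): if \<open>\<nu> \<ge> 0\<close> and there are a strictly positive
  supersolution for \<open>B\<^sub>\<nu>\<close> and a strictly positive subsolution for \<open>B\<^sub>\<mu>\<close>, then \<open>\<nu> \<le> \<mu>\<close>. The critical
  flux \<open>\<phi>\<close> is strictly positive by irreducibility, its quotient is the constant \<open>1 / k_eff\<close>, and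
  comparing it with an arbitrary \<open>f\<close>, once as a supersolution and once as a subsolution, gives both
  formulas.

  The comparison is proved by iteration. Suppose that \<open>\<mu> < \<nu>\<close>, and let \<open>B = B\<^sub>\<nu>\<close>, \<open>g\<close> the supersolution
  and \<open>f\<close> the subsolution. Then \<open>B g \<le> g\<close> and \<open>f + e \<le> B f\<close>, where \<open>e = (\<nu> - \<mu>) R Kf f\<close> is strictly
  positive. This forces \<open>f\<close> to vanish (\<open>no_strict_subsolution\<close>), a contradiction.

  \<^item> The powers of \<open>B\<close> are uniformly bounded (\<open>power_bounded_if_supersolution\<close>). Some power \<open>B\<^sup>n\<close> is
    dominated by a compact operator, and a compact set lies, up to uniformly small remainders,
    below a multiple of \<open>g\<close>, on which all powers of \<open>B\<close> are bounded since \<open>B g \<le> g\<close>.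
  \<^item> Therefore \<open>B\<^sup>N e\<close> tends to zero: \<open>B\<^sup>N f + B\<^sup>N e \<le> B\<^sup>N\<^sup>+\<^sup>1 f\<close>, and the integral of the \<open>p\<close>-th power is
    superadditive on nonnegative functions, so its bounded increasing values at \<open>B\<^sup>N f\<close> leave
    vanishing room for \<open>B\<^sup>N e\<close>.
  \<^item> Finally \<open>f \<le> B\<^sup>N f \<le> m B\<^sup>N e + B\<^sup>N (f - m e)\<^sup>+\<close>. The last term is small, uniformly in \<open>N\<close>, for
    large \<open>m\<close>, since \<open>e\<close> is strictly positive; then the other term is small for large \<open>N\<close>. Hence
    \<open>f\<close> is zero.

  Compactness is used through domination because \<open>B\<^sup>n\<close> is only known to lie below a multiple of the
  compact power of \<open>R (Ks + Kf)\<close>, and in \<open>L\<^sup>1\<close> a positive operator below a compact one can fail to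
  be compact.
\<close>

section \<open>The \<open>p\<close>-th power of the norm\<close>

text \<open>
  The \<open>p\<close>-th power of the norm is used throughout in place of the norm because it is superadditive
  on nonnegative functions, which the norm is not; the pointwise bound
  \<open>(a + b)\<^sup>p \<le> 2\<^sup>p (a\<^sup>p + b\<^sup>p)\<close> takes the place of the triangle inequality.
\<close>

definition Lp_pow :: "'a measure \<Rightarrow> real \<Rightarrow> ('a \<Rightarrow> complex) \<Rightarrow> real"
  where "Lp_pow M p f = (LINT x|M. norm (f x) powr p)"

lemma powr_add_le:
  fixes a b p :: real
  assumes "0 \<le> a" "0 \<le> b" "0 \<le> p"
  shows "(a + b) powr p \<le> 2 powr p * (a powr p + b powr p)"
proof -
  have "(a + b) powr p \<le> (2 * max a b) powr p"
    using assms by (intro powr_mono2) auto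
  also have "\<dots> = 2 powr p * max a b powr p"
    using assms by (simp add: powr_mult)
  also have "\<dots> \<le> 2 powr p * (a powr p + b powr p)"
    by (intro mult_left_mono) (auto simp: max_def)
  finally show ?thesis .
qed

text \<open>
  Each summand \<open>c\<close> satisfies \<open>c\<^sup>p = c c\<^sup>p\<^sup>-\<^sup>1 \<le> c (a + b)\<^sup>p\<^sup>-\<^sup>1\<close>.
\<close>

lemma powr_superadditive:
  fixes a b p :: real
  assumes "0 \<le> a" "0 \<le> b" "1 \<le> p"
  shows "a powr p + b powr p \<le> (a + b) powr p"
proof -
  have *: "c powr p \<le> c * (a + b) powr (p - 1)" if "0 \<le> c" "c \<le> a + b" for c
  proof (cases "c = 0")
    case False
    then have "c powr p = c * c powr (p - 1)"
      using that by (simp add: powr_mult_base)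
    also have "\<dots> \<le> c * (a + b) powr (p - 1)"
      using that assms by (intro mult_left_mono powr_mono2) auto
    finally show ?thesis .
  qed simp
  have "a powr p + b powr p \<le> a * (a + b) powr (p - 1) + b * (a + b) powr (p - 1)"
    using *[of a] *[of b] assms by simp
  also have "\<dots> = (a + b) * (a + b) powr (p - 1)"
    by (simp add: algebra_simps)
  also have "\<dots> = (a + b) powr p"
    using assms by (simp add: powr_mult_base)
  finally show ?thesis .
qed

lemma LpD:
  assumes "f \<in> Lp M p"
  shows "f \<in> borel_measurable M" "integrable M (\<lambda>x. norm (f x) powr p)"
  using assms by (auto simp: Lp_def)

lemma Lp_pow_nonneg: "0 \<le> Lp_pow M p f"
  by (simp add: Lp_pow_def)

lemma Lp_pow_eq_norm:
  assumes "1 \<le> p" shows "Lp_pow M p f = Lp_norm M p f powr p"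
  using assms by (simp add: Lp_norm_def Lp_pow_def powr_powr)

lemma Lp_dominated:
  assumes "g \<in> Lp M p" "f \<in> borel_measurable M" "AE x in M. norm (f x) \<le> norm (g x)" "0 \<le> p"
  shows "f \<in> Lp M p"
proof -
  have "integrable M (\<lambda>x. norm (f x) powr p)"
    by (rule Bochner_Integration.integrable_bound[OF LpD(2)[OF assms(1)]])
       (use assms in \<open>auto elim!: eventually_mono intro: powr_mono2\<close>)
  with assms show ?thesis by (simp add: Lp_def)
qed

lemma Lp_pow_mono:
  assumes "f \<in> Lp M p" "g \<in> Lp M p" "AE x in M. norm (f x) \<le> norm (g x)" "0 \<le> p"
  shows "Lp_pow M p f \<le> Lp_pow M p g"
  unfolding Lp_pow_def
  by (rule integral_mono_AE) (use assms LpD in \<open>auto elim!: eventually_mono intro: powr_mono2\<close>)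

lemma Lp_pow_cmult:
  "Lp_pow M p (\<lambda>x. c * f x) = norm c powr p * Lp_pow M p f"
  by (simp add: Lp_pow_def norm_mult powr_mult)

lemma Lp_cmult:
  assumes "f \<in> Lp M p" shows "(\<lambda>x. c * f x) \<in> Lp M p"
  using assms by (auto simp: Lp_def norm_mult powr_mult)

lemma Lp_add:
  assumes "f \<in> Lp M p" "g \<in> Lp M p" "0 \<le> p"
  shows "(\<lambda>x. f x + g x) \<in> Lp M p"
    and "Lp_pow M p (\<lambda>x. f x + g x) \<le> 2 powr p * (Lp_pow M p f + Lp_pow M p g)"
proof -
  note [measurable] = LpD(1)[OF assms(1)] LpD(1)[OF assms(2)]
  have int: "integrable M (\<lambda>x. 2 powr p * (norm (f x) powr p + norm (g x) powr p))"
    using LpD(2)[OF assms(1)] LpD(2)[OF assms(2)] by auto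
  have le: "norm (f x + g x) powr p \<le> 2 powr p * (norm (f x) powr p + norm (g x) powr p)" for x
    using powr_add_le[of "norm (f x)" "norm (g x)" p] assms
      powr_mono2[OF \<open>0 \<le> p\<close> norm_ge_zero norm_triangle_ineq[of "f x" "g x"]]
    by simp
  have int': "integrable M (\<lambda>x. norm (f x + g x) powr p)"
    by (rule Bochner_Integration.integrable_bound[OF int]) (use le in \<open>auto intro: order_trans\<close>)
  show "(\<lambda>x. f x + g x) \<in> Lp M p"
    using int' by (simp add: Lp_def)
  have "Lp_pow M p (\<lambda>x. f x + g x) \<le> (LINT x|M. 2 powr p * (norm (f x) powr p + norm (g x) powr p))"
    unfolding Lp_pow_def by (intro integral_mono int int' le)
  also have "\<dots> = 2 powr p * (Lp_pow M p f + Lp_pow M p g)"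
    using LpD(2)[OF assms(1)] LpD(2)[OF assms(2)] by (simp add: Lp_pow_def)
  finally show "Lp_pow M p (\<lambda>x. f x + g x) \<le> 2 powr p * (Lp_pow M p f + Lp_pow M p g)" .
qed

lemma Lp_diff:
  assumes "f \<in> Lp M p" "g \<in> Lp M p" "0 \<le> p"
  shows "(\<lambda>x. f x - g x) \<in> Lp M p"
  using Lp_add(1)[OF assms(1) Lp_cmult[OF assms(2), of "-1"] assms(3)] by simp

lemma Lp_pow_superadditive:
  assumes "f \<in> Lp M p" "g \<in> Lp M p" "nonneg M f" "nonneg M g" "1 \<le> p"
  shows "Lp_pow M p f + Lp_pow M p g \<le> Lp_pow M p (\<lambda>x. f x + g x)"
proof -
  have [simp]: "integrable M (\<lambda>x. norm (f x + g x) powr p)"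
    using LpD(2)[OF Lp_add(1)[OF assms(1,2)]] assms(5) by auto
  have "Lp_pow M p f + Lp_pow M p g = (LINT x|M. norm (f x) powr p + norm (g x) powr p)"
    using LpD(2)[OF assms(1)] LpD(2)[OF assms(2)] by (simp add: Lp_pow_def)
  also have "\<dots> \<le> Lp_pow M p (\<lambda>x. f x + g x)"
    unfolding Lp_pow_def
  proof (rule integral_mono_AE)
    show "AE x in M. norm (f x) powr p + norm (g x) powr p \<le> norm (f x + g x) powr p"
      using assms(3,4) unfolding nonneg_def
    proof eventually_elim
      case (elim x)
      then have "norm (f x + g x) = norm (f x) + norm (g x)"
        by (simp add: less_eq_complex_def cmod_eq_Re)
      then show ?case
        using powr_superadditive[of "norm (f x)" "norm (g x)" p] assms(5) by simp
    qed
  qed (use LpD(2)[OF assms(1)] LpD(2)[OF assms(2)] in auto)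
  finally show ?thesis .
qed

lemma Lp_pow_eq_0_iff:
  assumes "f \<in> Lp M p"
  shows "Lp_pow M p f = 0 \<longleftrightarrow> ae_eq M f (\<lambda>x. 0)"
  unfolding Lp_pow_def ae_eq_def
  by (subst integral_nonneg_eq_0_iff_AE) (use assms LpD in auto)

section \<open>Positive operators\<close>

definition positive_op ::
  "'a measure \<Rightarrow> real \<Rightarrow> (('a \<Rightarrow> complex) \<Rightarrow> ('a \<Rightarrow> complex)) \<Rightarrow> bool"
  where "positive_op M p B \<longleftrightarrow> bounded_op M p B \<and> nonneg_op M p B"

lemma norm_mono_complex: "0 \<le> (a::complex) \<Longrightarrow> a \<le> b \<Longrightarrow> norm a \<le> norm b"
  by (auto simp: less_eq_complex_def cmod_eq_Re)

lemma linear_opD: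
  assumes "linear_op M p (Lp M p) B"
  shows "f \<in> Lp M p \<Longrightarrow> B f \<in> Lp M p"
    and "f \<in> Lp M p \<Longrightarrow> g \<in> Lp M p \<Longrightarrow> AE x in M. f x = g x \<Longrightarrow> AE x in M. B f x = B g x"
    and "f \<in> Lp M p \<Longrightarrow> g \<in> Lp M p \<Longrightarrow> AE x in M. B (\<lambda>x. f x + g x) x = B f x + B g x"
    and "f \<in> Lp M p \<Longrightarrow> AE x in M. B (\<lambda>x. c * f x) x = c * B f x"
  using assms unfolding linear_op_def ae_eq_def by blast+

lemma linear_op_LpI:
  assumes "0 \<le> p"
    and "\<And>f. f \<in> Lp M p \<Longrightarrow> B f \<in> Lp M p"
    and "\<And>f g. f \<in> Lp M p \<Longrightarrow> g \<in> Lp M p \<Longrightarrow> AE x in M. f x = g x \<Longrightarrow> AE x in M. B f x = B g x"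
    and "\<And>f g. f \<in> Lp M p \<Longrightarrow> g \<in> Lp M p \<Longrightarrow> AE x in M. B (\<lambda>x. f x + g x) x = B f x + B g x"
    and "\<And>c f. f \<in> Lp M p \<Longrightarrow> AE x in M. B (\<lambda>x. c * f x) x = c * B f x"
  shows "linear_op M p (Lp M p) B"
proof -
  have "(\<lambda>x. 0) \<in> Lp M p" by (simp add: Lp_def)
  then show ?thesis
    using assms unfolding linear_op_def ae_eq_def by (auto intro: Lp_add Lp_cmult)
qed

lemma bounded_op_iff:
  assumes "1 \<le> p"
  shows "bounded_op M p B \<longleftrightarrow>
    linear_op M p (Lp M p) B \<and> (\<exists>b\<ge>0. \<forall>f\<in>Lp M p. Lp_pow M p (B f) \<le> b * Lp_pow M p f)"
proof -
  have "\<exists>b\<ge>0. \<forall>f\<in>Lp M p. Lp_pow M p (B f) \<le> b * Lp_pow M p f"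
    if C: "\<forall>f\<in>Lp M p. Lp_norm M p (B f) \<le> C * Lp_norm M p f" for C
  proof (intro exI[of _ "max C 0 powr p"] conjI ballI)
    fix f assume "f \<in> Lp M p"
    then have "Lp_norm M p (B f) \<le> max C 0 * Lp_norm M p f"
      using C by (smt (verit, best) Lp_norm_def mult_right_mono powr_ge_zero)
    then have "Lp_norm M p (B f) powr p \<le> (max C 0 * Lp_norm M p f) powr p"
      using assms by (intro powr_mono2) (auto simp: Lp_norm_def)
    then show "Lp_pow M p (B f) \<le> max C 0 powr p * Lp_pow M p f"
      by (simp add: Lp_pow_eq_norm[OF assms] powr_mult Lp_norm_def)
  qed simp
  moreover have "\<exists>C. \<forall>f\<in>Lp M p. Lp_norm M p (B f) \<le> C * Lp_norm M p f"
    if b: "b \<ge> 0" "\<forall>f\<in>Lp M p. Lp_pow M p (B f) \<le> b * Lp_pow M p f" for b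
  proof (intro exI[of _ "b powr (1 / p)"] ballI)
    fix f assume "f \<in> Lp M p"
    then have "Lp_pow M p (B f) powr (1 / p) \<le> (b * Lp_pow M p f) powr (1 / p)"
      using b assms by (intro powr_mono2) (auto simp: Lp_pow_nonneg)
    then show "Lp_norm M p (B f) \<le> b powr (1 / p) * Lp_norm M p f"
      using b by (simp add: Lp_norm_def Lp_pow_def powr_mult)
  qed
  ultimately show ?thesis
    unfolding bounded_op_def by blast
qed

lemma positive_opD:
  assumes "positive_op M p B"
  shows "linear_op M p (Lp M p) B"
    and "f \<in> Lp M p \<Longrightarrow> B f \<in> Lp M p"
    and "f \<in> Lp M p \<Longrightarrow> AE x in M. 0 \<le> f x \<Longrightarrow> AE x in M. 0 \<le> B f x"
    and "f \<in> Lp M p \<Longrightarrow> g \<in> Lp M p \<Longrightarrow> AE x in M. f x = g x \<Longrightarrow> AE x in M. B f x = B g x"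
    and "f \<in> Lp M p \<Longrightarrow> g \<in> Lp M p \<Longrightarrow> AE x in M. B (\<lambda>x. f x + g x) x = B f x + B g x"
    and "f \<in> Lp M p \<Longrightarrow> AE x in M. B (\<lambda>x. c * f x) x = c * B f x"
    and "1 \<le> p \<Longrightarrow> \<exists>b\<ge>0. \<forall>f\<in>Lp M p. Lp_pow M p (B f) \<le> b * Lp_pow M p f"
proof -
  show 1: "linear_op M p (Lp M p) B"
    using assms by (simp add: positive_op_def bounded_op_def)
  note 2 = linear_opD[OF 1]
  from 2 show "f \<in> Lp M p \<Longrightarrow> B f \<in> Lp M p"
    "f \<in> Lp M p \<Longrightarrow> g \<in> Lp M p \<Longrightarrow> AE x in M. f x = g x \<Longrightarrow> AE x in M. B f x = B g x"
    "f \<in> Lp M p \<Longrightarrow> g \<in> Lp M p \<Longrightarrow> AE x in M. B (\<lambda>x. f x + g x) x = B f x + B g x"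
    "f \<in> Lp M p \<Longrightarrow> AE x in M. B (\<lambda>x. c * f x) x = c * B f x" by blast+
  show "f \<in> Lp M p \<Longrightarrow> AE x in M. 0 \<le> f x \<Longrightarrow> AE x in M. 0 \<le> B f x"
    using assms by (simp add: positive_op_def nonneg_op_def nonneg_def)
  show "1 \<le> p \<Longrightarrow> \<exists>b\<ge>0. \<forall>f\<in>Lp M p. Lp_pow M p (B f) \<le> b * Lp_pow M p f"
    using assms bounded_op_iff positive_op_def by blast
qed

lemma positive_op_mono:
  assumes "positive_op M p B" "0 \<le> p" "f \<in> Lp M p" "g \<in> Lp M p" "AE x in M. f x \<le> g x"
  shows "AE x in M. B f x \<le> B g x"
proof -
  let ?d = "\<lambda>x. g x - f x"
  have d: "?d \<in> Lp M p"
    using assms by (intro Lp_diff)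
  have "AE x in M. 0 \<le> B ?d x"
    using assms(5) by (intro positive_opD(3)[OF assms(1) d]) auto
  moreover have "AE x in M. B (\<lambda>x. f x + ?d x) x = B f x + B ?d x"
    by (rule positive_opD(5)[OF assms(1,3) d])
  ultimately show ?thesis
    by eventually_elim simp
qed

lemma positive_op_comp:
  assumes "positive_op M p A" "positive_op M p B" "1 \<le> p"
  shows "positive_op M p (\<lambda>f. A (B f))"
proof -
  note A = positive_opD[OF assms(1)] and B = positive_opD[OF assms(2)]
  obtain a where a: "a \<ge> 0" "\<forall>f\<in>Lp M p. Lp_pow M p (A f) \<le> a * Lp_pow M p f"
    using A(7) assms(3) by blast
  obtain b where b: "b \<ge> 0" "\<forall>f\<in>Lp M p. Lp_pow M p (B f) \<le> b * Lp_pow M p f"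
    using B(7) assms(3) by blast
  have "linear_op M p (Lp M p) (\<lambda>f. A (B f))"
  proof (rule linear_op_LpI)
    fix f g assume fg: "f \<in> Lp M p" "g \<in> Lp M p"
    then have "AE x in M. A (B (\<lambda>x. f x + g x)) x = A (\<lambda>x. B f x + B g x) x"
      using assms(3) by (intro A(4) B(2) B(5) Lp_add) auto
    moreover have "AE x in M. A (\<lambda>x. B f x + B g x) x = A (B f) x + A (B g) x"
      using fg by (intro A(5) B(2))
    ultimately show "AE x in M. A (B (\<lambda>x. f x + g x)) x = A (B f) x + A (B g) x"
      by eventually_elim simp
  next
    fix c f assume f: "f \<in> Lp M p"
    then have "AE x in M. A (B (\<lambda>x. c * f x)) x = A (\<lambda>x. c * B f x) x"
      by (intro A(4) B(2) B(6) Lp_cmult)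
    moreover have "AE x in M. A (\<lambda>x. c * B f x) x = c * A (B f) x"
      using f by (intro A(6) B(2))
    ultimately show "AE x in M. A (B (\<lambda>x. c * f x)) x = c * A (B f) x"
      by eventually_elim simp
  qed (use assms A(2,4) B(2,4) in auto)
  moreover have "Lp_pow M p (A (B f)) \<le> (a * b) * Lp_pow M p f" if "f \<in> Lp M p" for f
  proof -
    have "Lp_pow M p (A (B f)) \<le> a * Lp_pow M p (B f)"
      using a that B(2) by blast
    also have "\<dots> \<le> a * (b * Lp_pow M p f)"
      using a b that by (intro mult_left_mono) auto
    finally show ?thesis by (simp add: mult.assoc)
  qed
  ultimately have "bounded_op M p (\<lambda>f. A (B f))"
    using a b bounded_op_iff[OF assms(3)] by (metis mult_nonneg_nonneg)
  then show ?thesis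
    using A(3) B(2,3) by (simp add: positive_op_def nonneg_op_def nonneg_def)
qed

lemma positive_op_add_cmult:
  assumes "positive_op M p A" "positive_op M p B" "1 \<le> p" "0 \<le> c"
  shows "positive_op M p (\<lambda>f x. A f x + complex_of_real c * B f x)"
proof -
  note A = positive_opD[OF assms(1)] and B = positive_opD[OF assms(2)]
  obtain a where a: "a \<ge> 0" "\<forall>f\<in>Lp M p. Lp_pow M p (A f) \<le> a * Lp_pow M p f"
    using A(7) assms(3) by blast
  obtain b where b: "b \<ge> 0" "\<forall>f\<in>Lp M p. Lp_pow M p (B f) \<le> b * Lp_pow M p f"
    using B(7) assms(3) by blast
  have "linear_op M p (Lp M p) (\<lambda>f x. A f x + complex_of_real c * B f x)"
  proof (rule linear_op_LpI)
    fix f g assume fg: "f \<in> Lp M p" "g \<in> Lp M p"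
    show "AE x in M. A (\<lambda>x. f x + g x) x + c * B (\<lambda>x. f x + g x) x =
       A f x + c * B f x + (A g x + c * B g x)"
      using A(5)[OF fg] B(5)[OF fg] by eventually_elim (simp add: algebra_simps)
  next
    fix d f assume f: "f \<in> Lp M p"
    show "AE x in M. A (\<lambda>x. d * f x) x + c * B (\<lambda>x. d * f x) x = d * (A f x + c * B f x)"
      using A(6)[OF f, of d] B(6)[OF f, of d] by eventually_elim (simp add: algebra_simps)
  next
    fix f g assume fg: "f \<in> Lp M p" "g \<in> Lp M p" "AE x in M. f x = g x"
    show "AE x in M. A f x + c * B f x = A g x + c * B g x"
      using A(4)[OF fg] B(4)[OF fg] by eventually_elim simp
  qed (use assms in \<open>auto intro!: Lp_add Lp_cmult A(2) B(2)\<close>)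
  moreover have "Lp_pow M p (\<lambda>x. A f x + c * B f x) \<le> (2 powr p * (a + c powr p * b)) * Lp_pow M p f"
    if f: "f \<in> Lp M p" for f
  proof -
    have "Lp_pow M p (\<lambda>x. A f x + c * B f x)
        \<le> 2 powr p * (Lp_pow M p (A f) + Lp_pow M p (\<lambda>x. c * B f x))"
      using f assms by (intro Lp_add Lp_cmult A(2) B(2)) auto
    also have "\<dots> \<le> 2 powr p * (a * Lp_pow M p f + c powr p * (b * Lp_pow M p f))"
      using a b f assms by (auto simp: Lp_pow_cmult intro!: mult_left_mono add_mono)
    finally show ?thesis by (simp add: algebra_simps)
  qed
  ultimately have "bounded_op M p (\<lambda>f x. A f x + complex_of_real c * B f x)"
    using a b assms unfolding bounded_op_iff[OF assms(3)]
    by (intro conjI exI[of _ "2 powr p * (a + c powr p * b)"]) auto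
  moreover have "nonneg_op M p (\<lambda>f x. A f x + complex_of_real c * B f x)"
    unfolding nonneg_op_def nonneg_def
  proof (intro ballI impI)
    fix f assume f: "f \<in> Lp M p" "AE x in M. 0 \<le> f x"
    show "AE x in M. 0 \<le> A f x + complex_of_real c * B f x"
      using A(3)[OF f] B(3)[OF f]
      by eventually_elim (use assms(4) in \<open>simp add: less_eq_complex_def\<close>)
  qed
  ultimately show ?thesis
    by (simp add: positive_op_def)
qed

lemma positive_op_id:
  assumes "1 \<le> p" shows "positive_op M p (\<lambda>f. f)"
proof -
  have "linear_op M p (Lp M p) (\<lambda>f. f)"
    using assms by (intro linear_op_LpI) auto
  then show ?thesis
    unfolding positive_op_def nonneg_op_def bounded_op_iff[OF assms]
    by (auto intro: exI[of _ 1])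
qed

lemma positive_op_funpow:
  assumes "positive_op M p B" "1 \<le> p"
  shows "positive_op M p (B ^^ n)"
proof (induction n)
  case 0
  then show ?case using positive_op_id[OF assms(2)] by (simp add: id_def)
next
  case (Suc n)
  then show ?case using positive_op_comp[OF assms(1) Suc assms(2)] by (simp add: o_def)
qed

section \<open>Power boundedness and strict subsolutions\<close>

text \<open>
  In a Banach lattice, \<open>(\<bar>u\<bar> - m \<bar>g\<bar>)\<^sup>+\<close>: what has to be removed from \<open>u\<close> to fit it into the order
  interval spanned by \<open>m g\<close>.
\<close>

definition excess :: "('a \<Rightarrow> complex) \<Rightarrow> ('a \<Rightarrow> complex) \<Rightarrow> real \<Rightarrow> 'a \<Rightarrow> complex"
  where "excess u g m x = complex_of_real (max 0 (norm (u x) - m * norm (g x)))"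

lemma excess_nonneg: "0 \<le> excess u g m x"
  by (simp add: excess_def less_eq_complex_def)

lemma norm_excess: "norm (excess u g m x) = max 0 (norm (u x) - m * norm (g x))"
  by (simp add: excess_def)

lemma Lp_excess:
  assumes "u \<in> Lp M p" "g \<in> Lp M p" "0 \<le> m" "0 \<le> p"
  shows "excess u g m \<in> Lp M p"
proof (rule Lp_dominated[OF assms(1)])
  note [measurable] = LpD(1)[OF assms(1)] LpD(1)[OF assms(2)]
  show "excess u g m \<in> borel_measurable M"
    unfolding excess_def by measurable
  show "AE x in M. norm (excess u g m x) \<le> norm (u x)"
    using assms by (simp add: norm_excess)
qed (use assms in auto)

lemma le_excess:
  assumes "0 \<le> u x" "0 \<le> g x"
  shows "u x \<le> complex_of_real m * g x + excess u g m x"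
proof -
  from assms have "norm (u x) = Re (u x)" "norm (g x) = Re (g x)"
    by (simp_all add: less_eq_complex_def cmod_eq_Re)
  with assms show ?thesis
    by (simp add: excess_def less_eq_complex_def)
qed

text \<open>
  Dominated convergence: \<open>\<bar>u\<bar>\<^sup>p\<close> is a majorant, and at a point where \<open>g\<close> is nonzero the excess vanishes
  as soon as \<open>m \<ge> \<bar>u\<bar> / \<bar>g\<bar>\<close>.
\<close>

lemma excess_tendsto_0:
  assumes u: "u \<in> Lp M p" and g: "g \<in> Lp M p" "AE x in M. g x \<noteq> 0" and p: "1 \<le> p"
  shows "(\<lambda>m. Lp_pow M p (excess u g (real m))) \<longlonglongrightarrow> 0"
proof -
  note [measurable] = LpD(1)[OF u] LpD(1)[OF g(1)]
  have "(\<lambda>m. LINT x|M. norm (excess u g (real m) x) powr p) \<longlonglongrightarrow> (LINT x|M. (0::real))"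
  proof (rule integral_dominated_convergence)
    show "(\<lambda>x. norm (excess u g (real m) x) powr p) \<in> borel_measurable M" for m
      using Lp_excess[OF u g(1), of "real m"] p by (auto dest: LpD)
    show "integrable M (\<lambda>x. norm (u x) powr p)"
      by (rule LpD(2)[OF u])
    show "AE x in M. (\<lambda>m. norm (excess u g (real m) x) powr p) \<longlonglongrightarrow> 0"
      using g(2)
    proof eventually_elim
      case (elim x)
      obtain N :: nat where N: "norm (u x) / norm (g x) \<le> real N"
        using real_arch_simple by blast
      have "norm (excess u g (real m) x) powr p = 0" if "m \<ge> N" for m
      proof -
        have "norm (u x) \<le> real N * norm (g x)"
          using N elim by (simp add: field_simps)
        also have "\<dots> \<le> real m * norm (g x)"
          using that by (simp add: mult_right_mono)
        finally show ?thesis by (simp add: norm_excess)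
      qed
      then show ?case
        by (intro tendsto_eventually) (auto simp: eventually_sequentially)
    qed
    show "AE x in M. norm (norm (excess u g (real m) x) powr p) \<le> norm (u x) powr p" for m
      using p by (auto simp: norm_excess intro!: powr_mono2)
  qed simp
  then show ?thesis
    by (simp add: Lp_pow_def)
qed

text \<open>
  The excess of \<open>u\<close> exceeds that of \<open>w\<close> by at most \<open>\<bar>u - w\<bar>\<close>. This transfers smallness of the excess
  from the limit of a sequence to its late members.
\<close>

lemma excess_perturb:
  assumes "u \<in> Lp M p" "w \<in> Lp M p" "g \<in> Lp M p" "0 \<le> m" "0 \<le> p"
  shows "Lp_pow M p (excess u g m)
    \<le> 2 powr p * (Lp_pow M p (\<lambda>x. u x - w x) + Lp_pow M p (excess w g m))"
proof -
  let ?d = "\<lambda>x. complex_of_real (norm (u x - w x))"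
  note [measurable] = LpD(1)[OF assms(1)] LpD(1)[OF assms(2)]
  have d: "?d \<in> Lp M p"
    by (rule Lp_dominated[OF Lp_diff[OF assms(1,2)]]) (use assms in auto)
  have "Lp_pow M p (excess u g m) \<le> Lp_pow M p (\<lambda>x. ?d x + excess w g m x)"
  proof (rule Lp_pow_mono)
    have "norm (excess u g m x) \<le> norm (?d x + excess w g m x)" for x
    proof -
      have "norm (u x) \<le> norm (u x - w x) + norm (w x)"
        by (metis diff_add_cancel norm_triangle_ineq)
      moreover have "norm (?d x + excess w g m x)
          = norm (u x - w x) + max 0 (norm (w x) - m * norm (g x))"
        unfolding excess_def of_real_add[symmetric] norm_of_real by simp
      ultimately show ?thesis by (simp add: norm_excess)
    qed
    then show "AE x in M. norm (excess u g m x) \<le> norm (?d x + excess w g m x)"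
      by simp
  qed (use assms d in \<open>auto intro!: Lp_excess Lp_add(1)\<close>)
  also have "\<dots> \<le> 2 powr p * (Lp_pow M p ?d + Lp_pow M p (excess w g m))"
    using assms d by (intro Lp_add(2) Lp_excess)
  finally show ?thesis
    by (simp add: Lp_pow_def)
qed

text \<open>
  For a single function the excess tends to zero; compactness makes this uniform on the image of
  the unit ball. Otherwise images \<open>H v\<^sub>m\<close> with large excess over \<open>m g\<close> would have a convergent
  subsequence, and the excess of its limit tends to zero.
\<close>

lemma compact_op_excess_uniform:
  assumes H: "compact_op M p H" and g: "g \<in> Lp M p" "AE x in M. g x \<noteq> 0"
    and p: "1 \<le> p" and "0 < e"
  shows "\<exists>m::nat. \<forall>v\<in>Lp M p. Lp_pow M p v \<le> 1 \<longrightarrow> Lp_pow M p (excess (H v) g m) \<le> e"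
proof (rule ccontr)
  assume "\<not> ?thesis"
  then obtain v where v: "\<And>m::nat. v m \<in> Lp M p" "\<And>m. Lp_pow M p (v m) \<le> 1"
    "\<And>m. Lp_pow M p (excess (H (v m)) g m) > e"
    by (metis not_le)
  have lin: "linear_op M p (Lp M p) H"
    using H by (simp add: compact_op_def)
  have "Lp_norm M p (v m) \<le> 1" for m
    using v(2)[of m] p unfolding Lp_norm_def Lp_pow_def
    by (simp add: powr_le1)
  with v(1) H obtain r w where r: "strict_mono (r :: nat \<Rightarrow> nat)" and w: "w \<in> Lp M p"
    and lim: "(\<lambda>n. Lp_norm M p (\<lambda>x. H (v (r n)) x - w x)) \<longlonglongrightarrow> 0"
    unfolding compact_op_def by blast
  have "(\<lambda>n. Lp_norm M p (\<lambda>x. H (v (r n)) x - w x) powr p) \<longlonglongrightarrow> 0 powr p"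
    using lim p by (intro tendsto_powr') (auto simp: Lp_norm_def)
  then have 1: "(\<lambda>n. Lp_pow M p (\<lambda>x. H (v (r n)) x - w x)) \<longlonglongrightarrow> 0"
    by (simp add: Lp_pow_eq_norm[OF p])
  have 2: "(\<lambda>n. Lp_pow M p (excess w g (real (r n)))) \<longlonglongrightarrow> 0"
    using LIMSEQ_subseq_LIMSEQ[OF excess_tendsto_0[OF w g p] r] by (simp add: o_def)
  have "(\<lambda>n. 2 powr p * (Lp_pow M p (\<lambda>x. H (v (r n)) x - w x) + Lp_pow M p (excess w g (real (r n)))))
      \<longlonglongrightarrow> 2 powr p * (0 + 0)"
    by (intro tendsto_intros 1 2)
  then have "\<forall>\<^sub>F n in sequentially.
      2 powr p * (Lp_pow M p (\<lambda>x. H (v (r n)) x - w x) + Lp_pow M p (excess w g (real (r n)))) < e"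
    using \<open>0 < e\<close> by (intro order_tendstoD) auto
  then obtain n where n:
    "2 powr p * (Lp_pow M p (\<lambda>x. H (v (r n)) x - w x) + Lp_pow M p (excess w g (real (r n)))) < e"
    using eventually_happens'[OF sequentially_bot] by blast
  have Hv: "H (v (r n)) \<in> Lp M p"
    by (intro linear_opD(1)[OF lin] v)
  have "Lp_pow M p (excess (H (v (r n))) g (r n))
      \<le> 2 powr p * (Lp_pow M p (\<lambda>x. H (v (r n)) x - w x) + Lp_pow M p (excess w g (real (r n))))"
    using p by (intro excess_perturb[OF Hv w g(1)]) auto
  also note n
  finally have "Lp_pow M p (excess (H (v (r n))) g (r n)) < e" .
  with v(3)[of "r n"] show False by simp
qed

text \<open>
  Let \<open>v\<close> be nonnegative with norm at most one. By domination and \<open>compact_op_excess_uniform\<close>,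
  \<open>B\<^sup>n v \<le> y + z\<close> where \<open>y\<close> is a fixed multiple of \<open>g\<close> and \<open>z\<close> is small. Applying \<open>B\<^sup>N\<close> does not
  raise \<open>y\<close>, as \<open>B g \<le> g\<close>, so the bound for \<open>B\<^sup>N\<^sup>+\<^sup>n\<close> is a constant plus a small multiple of the bound for
  \<open>B\<^sup>N\<close>. If that multiple is at most one half, the recursion stays bounded.
\<close>

lemma power_bounded_if_supersolution:
  assumes B: "positive_op M p B" and p: "1 \<le> p"
    and H: "compact_op M p H" "0 < C" "1 \<le> n"
    and dom: "\<And>v. v \<in> Lp M p \<Longrightarrow> nonneg M v \<Longrightarrow> AE x in M. (B ^^ n) v x \<le> complex_of_real C * H v x"
    and g: "g \<in> Lp_pos M p" "AE x in M. B g x \<le> g x"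
  shows "\<exists>K\<ge>0. \<forall>N. \<forall>v\<in>Lp M p. nonneg M v \<longrightarrow> Lp_pow M p ((B ^^ N) v) \<le> K * Lp_pow M p v"
proof -
  have p0: "0 \<le> p" using p by simp
  note BB = positive_op_funpow[OF B p]
  note D = positive_opD[OF BB] and mono = positive_op_mono[OF BB p0]
  have lin: "linear_op M p (Lp M p) H"
    using H by (simp add: compact_op_def)
  have gL: "g \<in> Lp M p" and gpos: "AE x in M. 0 < g x"
    using g by (auto simp: Lp_pos_def)
  then have g0: "AE x in M. g x \<noteq> 0" by (auto elim: eventually_mono)
  have gnn: "AE x in M. 0 \<le> g x"
    using gpos by eventually_elim simp
  have Bg: "AE x in M. (B ^^ N) g x \<le> g x" for N
  proof (induction N)
    case (Suc N)
    have "AE x in M. (B ^^ N) (B g) x \<le> (B ^^ N) g x"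
      by (rule mono[OF positive_opD(2)[OF B gL] gL g(2)])
    with Suc show ?case
      unfolding funpow_Suc_right o_def by eventually_elim (rule order_trans)
  qed simp
  \<comment> \<open>the tolerance absorbs the scaling by \<open>C\<close> and the factor \<open>2\<^sup>p\<close>, leaving a contraction by one half\<close>
  have "\<exists>m::nat. \<forall>v\<in>Lp M p. Lp_pow M p v \<le> 1 \<longrightarrow>
      Lp_pow M p (excess (H v) g m) \<le> 1 / (2 * (2 powr p * C powr p))"
    using H by (intro compact_op_excess_uniform[OF H(1) gL g0 p]) auto
  then obtain m :: nat where m: "\<And>v. v \<in> Lp M p \<Longrightarrow> Lp_pow M p v \<le> 1 \<Longrightarrow>
      2 powr p * C powr p * Lp_pow M p (excess (H v) g m) \<le> 1 / 2"
    using H by (auto simp: field_simps)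
  define c where "c = 2 powr p * (C * real m) powr p * Lp_pow M p g"
  \<comment> \<open>bounds for the individual powers, possibly growing with \<open>N\<close>; they only start the induction\<close>
  have "\<exists>b\<ge>0. \<forall>f\<in>Lp M p. Lp_pow M p ((B ^^ N) f) \<le> b * Lp_pow M p f" for N
    using D(7) p by blast
  then obtain b where b: "\<And>N. 0 \<le> b N"
    "\<And>N f. f \<in> Lp M p \<Longrightarrow> Lp_pow M p ((B ^^ N) f) \<le> b N * Lp_pow M p f"
    by metis
  \<comment> \<open>the term \<open>2 * c\<close> is stable under the recursion \<open>K \<mapsto> c + K / 2\<close>; the sum covers the exponents below \<open>n\<close>\<close>
  define K where "K = 2 * c + (\<Sum>N<n. b N)"
  have c0: "0 \<le> c" by (simp add: c_def Lp_pow_nonneg)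
  have K0: "0 \<le> K" using c0 b by (simp add: K_def sum_nonneg)
  have unit: "Lp_pow M p ((B ^^ N) v) \<le> K"
    if IH: "\<And>N' v. N' < N \<Longrightarrow> v \<in> Lp M p \<Longrightarrow> nonneg M v \<Longrightarrow> Lp_pow M p ((B ^^ N') v) \<le> K * Lp_pow M p v"
      and v: "v \<in> Lp M p" "nonneg M v" "Lp_pow M p v \<le> 1" and "n \<le> N" for N v
  proof -
    obtain N' where N': "N = N' + n" using \<open>n \<le> N\<close> le_Suc_ex by (metis add.commute)
    have "N' < N" using N' H by simp
    define z where "z = (\<lambda>x. complex_of_real C * excess (H v) g m x)"
    define y where "y = (\<lambda>x. complex_of_real (C * real m) * g x)"
    have Hv: "H v \<in> Lp M p" by (rule linear_opD(1)[OF lin v(1)])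
    have zL: "z \<in> Lp M p" and yL: "y \<in> Lp M p"
      unfolding z_def y_def using p by (auto intro!: Lp_cmult Lp_excess Hv gL)
    have z0: "nonneg M z"
      using H excess_nonneg[of "H v" g m] unfolding nonneg_def z_def
      by (auto simp: less_eq_complex_def)
    have yz: "(\<lambda>x. y x + z x) \<in> Lp M p"
      by (rule Lp_add(1)[OF yL zL p0])
    have Bn0: "AE x in M. 0 \<le> (B ^^ n) v x"
      using v by (intro D(3)) (simp_all add: nonneg_def)
    have "AE x in M. (B ^^ n) v x \<le> y x + z x"
      using dom[OF v(1,2)] Bn0 gnn
    proof eventually_elim
      case (elim x)
      then have "0 \<le> complex_of_real C * H v x" by simp
      then have Hv0: "0 \<le> H v x"
        using H by (auto simp: less_eq_complex_def zero_le_mult_iff)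
      have "complex_of_real C * H v x
          \<le> complex_of_real C * (complex_of_real m * g x + excess (H v) g m x)"
        using H le_excess[where u = "H v" and g = g and x = x and m = m] Hv0 elim(3)
        by (intro mult_left_mono) (auto simp: less_eq_complex_def)
      with elim show ?case
        by (simp add: y_def z_def algebra_simps)
    qed
    then have "AE x in M. (B ^^ N') ((B ^^ n) v) x \<le> (B ^^ N') (\<lambda>x. y x + z x) x"
      by (intro mono D(2) v yz)
    moreover have "AE x in M. (B ^^ N') (\<lambda>x. y x + z x) x = (B ^^ N') y x + (B ^^ N') z x"
      by (rule D(5)[OF yL zL])
    moreover have "AE x in M. (B ^^ N') y x = complex_of_real (C * real m) * (B ^^ N') g x"
      unfolding y_def by (rule D(6)[OF gL])
    moreover have "AE x in M. 0 \<le> (B ^^ N') ((B ^^ n) v) x"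
      by (rule D(3)[OF D(2)[OF v(1)] Bn0])
    ultimately have le: "AE x in M. norm ((B ^^ N) v x) \<le> norm (y x + (B ^^ N') z x)"
      using Bg[of N']
    proof eventually_elim
      case (elim x)
      have "complex_of_real (C * real m) * (B ^^ N') g x \<le> y x"
        using elim(5) H unfolding y_def
        by (intro mult_left_mono) (auto simp: less_eq_complex_def)
      then have "(B ^^ N') y x + (B ^^ N') z x \<le> y x + (B ^^ N') z x"
        unfolding elim(3) by (rule add_right_mono)
      with elim(1)[unfolded elim(2)] have "(B ^^ N') ((B ^^ n) v) x \<le> y x + (B ^^ N') z x"
        by (rule order_trans)
      with elim(4) show ?case
        unfolding N' funpow_add o_def by (rule norm_mono_complex)
    qed
    have "Lp_pow M p ((B ^^ N) v) \<le> Lp_pow M p (\<lambda>x. y x + (B ^^ N') z x)"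
      by (rule Lp_pow_mono[OF _ _ le p0]) (auto intro!: D(2) v Lp_add(1) yL zL p0)
    also have "\<dots> \<le> 2 powr p * (Lp_pow M p y + Lp_pow M p ((B ^^ N') z))"
      by (intro Lp_add(2) D(2) zL yL p0)
    also have "\<dots> \<le> 2 powr p * (Lp_pow M p y + K * Lp_pow M p z)"
      using IH[OF \<open>N' < N\<close> zL z0] by (intro mult_left_mono add_left_mono) auto
    also have "\<dots> = c + K * (2 powr p * C powr p * Lp_pow M p (excess (H v) g m))"
      using H unfolding y_def z_def Lp_pow_cmult c_def norm_of_real
      by (simp add: algebra_simps abs_mult)
    also have "\<dots> \<le> c + K * (1 / 2)"
      using K0 m[OF v(1,3)] by (intro add_left_mono mult_left_mono) auto
    also have "\<dots> \<le> K"
      using b by (simp add: K_def sum_nonneg)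
    finally show ?thesis .
  qed
  have "Lp_pow M p ((B ^^ N) v) \<le> K * Lp_pow M p v" if "v \<in> Lp M p" "nonneg M v" for N v
    using that
  proof (induction N arbitrary: v rule: less_induct)
    case (less N v)
    show ?case
    proof (cases "N < n \<or> Lp_pow M p v = 0")
      case True
      then have "b N \<le> K \<or> Lp_pow M p v = 0"
        using c0 b member_le_sum[of N "{..<n}" b] by (auto simp: K_def)
      then have "b N * Lp_pow M p v \<le> K * Lp_pow M p v"
        by (auto intro: mult_right_mono Lp_pow_nonneg)
      then show ?thesis
        using b(2)[OF less.prems(1), of N] by linarith
    next
      case False
      define t where "t = Lp_pow M p v powr (- 1 / p)"
      have pos: "0 < Lp_pow M p v"
        using False Lp_pow_nonneg[of M p v] by linarith
      have "t powr p = Lp_pow M p v powr (- 1)"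
        unfolding t_def powr_powr using p by simp
      with pos have t: "0 < t" "t powr p = 1 / Lp_pow M p v"
        by (simp_all add: t_def powr_neg_one)
      let ?w = "\<lambda>x. complex_of_real t * v x"
      have "Lp_pow M p ((B ^^ N) ?w) \<le> K"
      proof (rule unit)
        show "?w \<in> Lp M p" by (intro Lp_cmult less.prems)
        show "nonneg M ?w"
          using less.prems(2) t(1) unfolding nonneg_def
          by (auto simp: less_eq_complex_def elim!: eventually_mono)
        show "Lp_pow M p ?w \<le> 1"
          using t pos by (simp add: Lp_pow_cmult)
      qed (use False less.IH in auto)
      moreover have "Lp_pow M p ((B ^^ N) ?w) = Lp_pow M p (\<lambda>x. complex_of_real t * (B ^^ N) v x)"
        using D(6)[OF less.prems(1), of N t]
        by (intro antisym Lp_pow_mono Lp_cmult D(2) less.prems p0) (auto elim: eventually_mono)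
      ultimately show ?thesis
        using t pos by (simp add: Lp_pow_cmult field_simps)
    qed
  qed
  with K0 show ?thesis by blast
qed

text \<open>
  A strict subsolution grows by \<open>B\<^sup>N e\<close> in step \<open>N\<close>. Bounded powers leave room only for increments
  tending to zero, and since \<open>f\<close> is, up to a small excess, below a multiple of \<open>e\<close>, the function \<open>f\<close>
  is pushed to zero as well. The supersolution \<open>g\<close> is what bounds the powers.
\<close>

lemma no_strict_subsolution:
  assumes B: "positive_op M p B" and p: "1 \<le> p"
    and H: "compact_op M p H" "0 < C" "1 \<le> n"
    and dom: "\<And>v. v \<in> Lp M p \<Longrightarrow> nonneg M v \<Longrightarrow> AE x in M. (B ^^ n) v x \<le> complex_of_real C * H v x"
    and g: "g \<in> Lp_pos M p" "AE x in M. B g x \<le> g x"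
    and f: "f \<in> Lp M p" "nonneg M f" and e: "e \<in> Lp_pos M p"
    and fe: "AE x in M. f x + e x \<le> B f x"
  shows "ae_eq M f (\<lambda>x. 0)"
proof -
  have p0: "0 \<le> p" using p by simp
  note BB = positive_op_funpow[OF B p]
  note D = positive_opD[OF BB] and mono = positive_op_mono[OF BB p0]
  obtain K where K: "0 \<le> K"
    "\<And>N v. v \<in> Lp M p \<Longrightarrow> nonneg M v \<Longrightarrow> Lp_pow M p ((B ^^ N) v) \<le> K * Lp_pow M p v"
    using power_bounded_if_supersolution[OF B p H dom g] by blast
  have eL: "e \<in> Lp M p" and epos: "AE x in M. 0 < e x"
    using e by (auto simp: Lp_pos_def)
  have e0: "AE x in M. e x \<noteq> 0" and enn: "AE x in M. 0 \<le> e x"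
    using epos by (auto elim: eventually_mono)
  have fnn: "AE x in M. 0 \<le> f x"
    using f by (simp add: nonneg_def)
  have fB: "f \<in> Lp M p" "B f \<in> Lp M p" "(\<lambda>x. f x + e x) \<in> Lp M p"
    using f eL positive_opD(2)[OF B] by (auto intro: Lp_add p0)
  have step: "AE x in M. (B ^^ N) f x + (B ^^ N) e x \<le> (B ^^ Suc N) f x" for N
    using mono[OF fB(3,2) fe, of N] D(5)[OF f(1) eL, of N]
    unfolding funpow_Suc_right o_def by eventually_elim simp
  have nn: "AE x in M. 0 \<le> (B ^^ N) f x" "AE x in M. 0 \<le> (B ^^ N) e x" for N
    using D(3)[OF f(1) fnn] D(3)[OF eL enn] by auto
  have grow: "Lp_pow M p ((B ^^ N) f) + Lp_pow M p ((B ^^ N) e) \<le> Lp_pow M p ((B ^^ Suc N) f)" for N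
  proof -
    have "Lp_pow M p ((B ^^ N) f) + Lp_pow M p ((B ^^ N) e)
        \<le> Lp_pow M p (\<lambda>x. (B ^^ N) f x + (B ^^ N) e x)"
      using nn by (intro Lp_pow_superadditive D(2) f eL p) (auto simp: nonneg_def)
    also have "\<dots> \<le> Lp_pow M p ((B ^^ Suc N) f)"
    proof (rule Lp_pow_mono)
      show "AE x in M. norm ((B ^^ N) f x + (B ^^ N) e x) \<le> norm ((B ^^ Suc N) f x)"
        using step[of N] nn(1)[of N] nn(2)[of N]
        by eventually_elim (intro norm_mono_complex add_nonneg_nonneg)
    qed (intro Lp_add D(2) f eL p0)+
    finally show ?thesis .
  qed
  have "incseq (\<lambda>N. Lp_pow M p ((B ^^ N) f))"
  proof (rule incseq_SucI)
    show "Lp_pow M p ((B ^^ N) f) \<le> Lp_pow M p ((B ^^ Suc N) f)" for N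
      using grow[of N] Lp_pow_nonneg[of M p "(B ^^ N) e"] by linarith
  qed
  moreover have "\<forall>N. Lp_pow M p ((B ^^ N) f) \<le> K * Lp_pow M p f"
    using K f by blast
  ultimately obtain L where L: "(\<lambda>N. Lp_pow M p ((B ^^ N) f)) \<longlonglongrightarrow> L"
    using incseq_convergent by metis
  have "(\<lambda>N. Lp_pow M p ((B ^^ Suc N) f) - Lp_pow M p ((B ^^ N) f)) \<longlonglongrightarrow> L - L"
    by (intro tendsto_diff L LIMSEQ_Suc[OF L])
  then have diff0: "(\<lambda>N. Lp_pow M p ((B ^^ Suc N) f) - Lp_pow M p ((B ^^ N) f)) \<longlonglongrightarrow> 0"
    by simp
  have Be0: "(\<lambda>N. Lp_pow M p ((B ^^ N) e)) \<longlonglongrightarrow> 0"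
  proof (rule tendsto_sandwich[OF _ _ tendsto_const diff0])
    show "\<forall>\<^sub>F N in sequentially.
        Lp_pow M p ((B ^^ N) e) \<le> Lp_pow M p ((B ^^ Suc N) f) - Lp_pow M p ((B ^^ N) f)"
      using grow by (intro always_eventually allI) (simp only: le_diff_eq add.commute)
  qed (simp add: Lp_pow_nonneg)
  have ge: "AE x in M. f x \<le> (B ^^ N) f x" for N
  proof (induction N)
    case (Suc N)
    with step[of N] nn(2)[of N] show ?case
      by eventually_elim (meson add_increasing2 order_trans)
  qed simp
  have bound: "Lp_pow M p f \<le> 2 powr p * (real m powr p * Lp_pow M p ((B ^^ N) e)
      + K * Lp_pow M p (excess f e m))" for m N :: nat
  proof -
    let ?y = "\<lambda>x. complex_of_real (real m) * e x" and ?z = "excess f e m"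
    have yL: "?y \<in> Lp M p" and zL: "?z \<in> Lp M p"
      using p by (auto intro!: Lp_cmult Lp_excess f eL)
    have "AE x in M. f x \<le> ?y x + ?z x"
      using fnn enn by eventually_elim (rule le_excess[of f _ e "real m"])
    then have "AE x in M. (B ^^ N) f x \<le> (B ^^ N) (\<lambda>x. ?y x + ?z x) x"
      by (intro mono f Lp_add yL zL p0)
    then have "AE x in M. norm (f x) \<le> norm (complex_of_real m * (B ^^ N) e x + (B ^^ N) ?z x)"
      using D(5)[OF yL zL, of N] D(6)[OF eL, of N "complex_of_real m"] ge[of N] fnn
      by eventually_elim (intro norm_mono_complex; simp)
    then have "Lp_pow M p f \<le> Lp_pow M p (\<lambda>x. complex_of_real m * (B ^^ N) e x + (B ^^ N) ?z x)"
      by (intro Lp_pow_mono f Lp_add Lp_cmult D(2) eL zL p0)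
    also have "\<dots> \<le> 2 powr p * (Lp_pow M p (\<lambda>x. complex_of_real m * (B ^^ N) e x) + Lp_pow M p ((B ^^ N) ?z))"
      by (intro Lp_add Lp_cmult D(2) eL zL p0)
    also have "\<dots> \<le> 2 powr p * (real m powr p * Lp_pow M p ((B ^^ N) e) + K * Lp_pow M p ?z)"
      using K(2)[OF zL, of N] excess_nonneg[of f e m]
      by (intro mult_left_mono add_mono) (auto simp: Lp_pow_cmult nonneg_def)
    finally show ?thesis .
  qed
  \<comment> \<open>the order of the limits matters: first \<open>N\<close>, for fixed \<open>m\<close>, and then \<open>m\<close>\<close>
  have "(\<lambda>N. 2 powr p * (real m powr p * Lp_pow M p ((B ^^ N) e) + K * Lp_pow M p (excess f e m)))
      \<longlonglongrightarrow> 2 powr p * (real m powr p * 0 + K * Lp_pow M p (excess f e m))" for m :: nat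
    by (intro tendsto_intros Be0)
  then have "Lp_pow M p f \<le> 2 powr p * (real m powr p * 0 + K * Lp_pow M p (excess f e m))" for m :: nat
    by (rule LIMSEQ_le_const) (use bound in blast)
  then have "Lp_pow M p f \<le> 2 powr p * (K * Lp_pow M p (excess f e m))" for m :: nat
    by simp
  moreover have "(\<lambda>m. 2 powr p * (K * Lp_pow M p (excess f e (real m)))) \<longlonglongrightarrow> 2 powr p * (K * 0)"
    by (intro tendsto_intros excess_tendsto_0 f eL e0 p)
  ultimately have "Lp_pow M p f \<le> 2 powr p * (K * 0)"
    by (intro LIMSEQ_le_const) blast+
  then have "Lp_pow M p f = 0"
    using Lp_pow_nonneg[of M p f] by simp
  then show ?thesis
    using Lp_pow_eq_0_iff[OF f(1)] by simp
qed

section \<open>Positivity and reality of the resolvent\<close>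

lemma is_resolvent_0:
  assumes "spectral_bound M p D T < 0"
  shows "is_resolvent M p D T 0 (resolvent M p D T 0)"
proof -
  have "0 \<notin> op_spectrum M p D T"
  proof
    assume "0 \<in> op_spectrum M p D T"
    then have "ereal (Re 0) \<le> spectral_bound M p D T"
      unfolding spectral_bound_def by (rule SUP_upper)
    with assms show False by (simp add: zero_ereal_def)
  qed
  then have "\<exists>R. is_resolvent M p D T 0 R"
    by (simp add: op_spectrum_def)
  then show ?thesis
    unfolding resolvent_def by (rule someI_ex)
qed

lemma is_resolvent_0D:
  assumes "is_resolvent M p D T 0 R"
  shows "h \<in> Lp M p \<Longrightarrow> R h \<in> D"
    and "h \<in> Lp M p \<Longrightarrow> AE x in M. - T (R h) x = h x"
    and "f \<in> D \<Longrightarrow> AE x in M. R (\<lambda>x. - T f x) x = f x"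
  using assms by (auto simp: is_resolvent_def ae_eq_def)

text \<open>
  The upper bound \<open>1\<close> puts one and the same weight into \<open>L\<^sup>q\<close> for every \<open>1 \<le> q \<le> \<infinity>\<close>, so that it serves
  both in \<open>L\<^sup>p\<close> and as a test function in the dual space.
\<close>

lemma (in sigma_finite_measure) Ex_positive_weight:
  "\<exists>w :: 'a \<Rightarrow> real. integrable M w \<and> (\<forall>x\<in>space M. 0 < w x) \<and> (\<forall>x. w x \<le> 1)"
proof -
  obtain h where h: "h \<in> borel_measurable M" "integral\<^sup>N M h \<noteq> \<infinity>"
    "\<And>x. x \<in> space M \<Longrightarrow> 0 < h x \<and> h x < \<infinity>"
    using Ex_finite_integrable_function by blast
  define w where "w x = min 1 (enn2real (h x))" for x
  have meas: "w \<in> borel_measurable M"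
    using h(1) unfolding w_def by measurable
  have "(\<integral>\<^sup>+ x. ennreal (norm (w x)) \<partial>M) \<le> integral\<^sup>N M h"
  proof (rule nn_integral_mono)
    fix x assume "x \<in> space M"
    then have "ennreal (enn2real (h x)) = h x"
      using h(3) by simp
    moreover have "ennreal (norm (w x)) \<le> ennreal (enn2real (h x))"
      unfolding w_def by (intro ennreal_leI) simp
    ultimately show "ennreal (norm (w x)) \<le> h x" by simp
  qed
  then have "integrable M w"
    using h(2) meas by (intro integrableI_bounded) (auto simp: top.not_eq_extremum order_le_less_trans)
  moreover have "0 < w x" if "x \<in> space M" for x
    using h(3)[OF that] by (simp add: w_def enn2real_positive_iff)
  ultimately show ?thesis
    by (intro exI[of _ w]) (simp add: w_def)
qed

lemma Lp_weight:
  assumes w: "integrable M w" "\<And>x. x \<in> space M \<Longrightarrow> 0 < w x" "\<And>x. w x \<le> (1::real)" and "1 \<le> q"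
  shows "(\<lambda>x. complex_of_real (w x)) \<in> Lp M q"
proof -
  have "integrable M (\<lambda>x. norm (complex_of_real (w x)) powr q)"
  proof (rule Bochner_Integration.integrable_bound[OF w(1)])
    show "AE x in M. norm (norm (complex_of_real (w x)) powr q) \<le> norm (w x)"
    proof (rule AE_I2)
      fix x assume "x \<in> space M"
      then have "w x powr q \<le> w x powr 1"
        using w(2)[of x] w(3)[of x] \<open>1 \<le> q\<close> by (intro powr_mono') auto
      then show "norm (norm (complex_of_real (w x)) powr q) \<le> norm (w x)"
        using w(2)[OF \<open>x \<in> space M\<close>] by simp
    qed
  qed (use w(1) in measurable)
  with w(1) show ?thesis
    by (simp add: Lp_def)
qed

text \<open>
  A nonnegative \<open>f\<close> is the limit of the strictly positive functions \<open>f + w / k\<close>, where \<open>w\<close> is a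
  strictly positive element of \<open>L\<^sup>p\<close>; by linearity the inequalities \<open>R f + R w / k > 0\<close> pass to the
  limit almost everywhere.
\<close>

lemma nonneg_op_if_strictly_positive:
  assumes "sigma_finite_measure M" "1 \<le> p" "bounded_op M p R" "R ` Lp_pos M p \<subseteq> Lp_pos M p"
  shows "nonneg_op M p R"
  unfolding nonneg_op_def nonneg_def
proof (intro ballI impI)
  fix f assume f: "f \<in> Lp M p" "AE x in M. 0 \<le> f x"
  interpret sigma_finite_measure M by fact
  obtain w :: "'a \<Rightarrow> real" where w: "integrable M w" "\<And>x. x \<in> space M \<Longrightarrow> 0 < w x" "\<And>x. w x \<le> 1"
    using Ex_positive_weight by blast
  let ?w = "\<lambda>x. complex_of_real (w x)"
  have wL: "?w \<in> Lp M p"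
    by (rule Lp_weight[OF w assms(2)])
  have R: "linear_op M p (Lp M p) R"
    using assms by (simp add: bounded_op_def)
  note lin = linear_opD[OF R]
  have pos: "AE x in M. 0 < R h x" if "h \<in> Lp M p" "AE x in M. 0 < h x" for h
    using that assms(4) unfolding Lp_pos_def by blast
  have Rw: "AE x in M. 0 < R ?w x"
    using w(2) by (intro pos wL AE_I2) (simp add: less_complex_def)
  have "AE x in M. 0 < R f x + complex_of_real (1 / real (Suc k)) * R ?w x" for k
  proof -
    let ?c = "complex_of_real (1 / real (Suc k))"
    have cw: "(\<lambda>x. ?c * ?w x) \<in> Lp M p"
      by (intro Lp_cmult wL)
    have "AE x in M. 0 < f x + ?c * ?w x"
      using f(2) AE_space
    proof eventually_elim
      case (elim x)
      have "0 < 1 / real (Suc k) * w x"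
        using w(2)[OF elim(2)] by simp
      then show ?case
        using elim(1) unfolding of_real_mult[symmetric]
        by (simp add: less_complex_def less_eq_complex_def)
    qed
    then have "AE x in M. 0 < R (\<lambda>x. f x + ?c * ?w x) x"
      using assms(2) by (intro pos Lp_add f cw) auto
    then show ?thesis
      using lin(3)[OF f(1) cw] lin(4)[OF wL, of ?c] by eventually_elim simp
  qed
  then have "AE x in M. \<forall>k. 0 < R f x + complex_of_real (1 / real (Suc k)) * R ?w x"
    by (simp add: AE_all_countable)
  then show "AE x in M. 0 \<le> R f x"
    using Rw
  proof eventually_elim
    case (elim x)
    have aux: "0 < Re a + r * Re b \<and> 0 = Im a + r * Im b" if "0 < a + complex_of_real r * b" for a b r
      using that by (simp add: less_complex_def)
    have k: "0 < Re (R f x) + 1 / real (Suc k) * Re (R ?w x)"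
      "0 = Im (R f x) + 1 / real (Suc k) * Im (R ?w x)" for k
      using aux[OF elim(1)[rule_format]] by auto
    have "Im (R f x) = 0"
      using k(2)[of 0] elim(2) by (simp add: less_complex_def)
    moreover have "(\<lambda>k. Re (R f x) + 1 / real (Suc k) * Re (R ?w x)) \<longlonglongrightarrow> Re (R f x) + 0 * Re (R ?w x)"
      by (intro tendsto_intros LIMSEQ_Suc lim_1_over_n)
    then have "0 \<le> Re (R f x) + 0 * Re (R ?w x)"
      by (rule LIMSEQ_le_const) (use k(1) in \<open>auto intro: less_imp_le\<close>)
    ultimately show ?case
      by (simp add: less_eq_complex_def)
  qed
qed

lemma positive_op_real:
  assumes B: "positive_op M p B" and p: "0 \<le> p" and f: "f \<in> Lp M p" "AE x in M. Im (f x) = 0"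
  shows "AE x in M. Im (B f x) = 0"
proof -
  note [measurable] = LpD(1)[OF f(1)]
  let ?a = "\<lambda>x. complex_of_real (max 0 (Re (f x)))"
  let ?b = "\<lambda>x. complex_of_real (max 0 (- Re (f x)))"
  have a: "?a \<in> Lp M p" and b: "?b \<in> Lp M p"
    using p abs_Re_le_cmod by (auto intro!: Lp_dominated[OF f(1)] simp: abs_le_iff)
  have "AE x in M. B f x = B (\<lambda>x. ?a x + (- 1) * ?b x) x"
    using f(2) by (intro positive_opD(4)[OF B] f Lp_add Lp_cmult a b p)
      (auto simp: complex_eq_iff elim!: eventually_mono)
  moreover have "AE x in M. B (\<lambda>x. ?a x + (- 1) * ?b x) x = B ?a x + B (\<lambda>x. (- 1) * ?b x) x"
    by (intro positive_opD(5)[OF B] Lp_cmult a b)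
  moreover have "AE x in M. B (\<lambda>x. (- 1) * ?b x) x = (- 1) * B ?b x"
    by (rule positive_opD(6)[OF B b])
  moreover have "AE x in M. 0 \<le> B ?a x"
    by (rule positive_opD(3)[OF B a]) (simp add: less_eq_complex_def)
  moreover have "AE x in M. 0 \<le> B ?b x"
    by (rule positive_opD(3)[OF B b]) (simp add: less_eq_complex_def)
  ultimately show ?thesis
    by eventually_elim (simp add: less_eq_complex_def)
qed

text \<open>
  The quotient in the theorem only sees the real part of \<open>T f\<close>, so it must be known that \<open>T f\<close> is real
  for real \<open>f\<close>. The resolvent maps real functions to real ones, hence \<open>R\<close> annihilates the imaginary
  part of \<open>- T f\<close>; but \<open>R\<close> is injective.
\<close>

lemma generator_real:
  assumes T: "linear_op M p D T" and res: "is_resolvent M p D T 0 R"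
    and R: "positive_op M p R" and p: "0 \<le> p"
    and f: "f \<in> D" "AE x in M. Im (f x) = 0"
  shows "AE x in M. Im (T f x) = 0"
proof -
  note res = is_resolvent_0D[OF res]
  have h: "(\<lambda>x. - T f x) \<in> Lp M p"
    using T f(1) Lp_cmult[of "T f" M p "-1"] by (simp add: linear_op_def)
  note [measurable] = LpD(1)[OF h]
  let ?a = "\<lambda>x. complex_of_real (Re (- T f x))"
  let ?b = "\<lambda>x. complex_of_real (Im (- T f x))"
  have a: "?a \<in> Lp M p"
    by (rule Lp_dominated[OF h]) (use p LpD(1)[OF h] abs_Re_le_cmod[of "T f _"] in auto)
  have b: "?b \<in> Lp M p"
    by (rule Lp_dominated[OF h]) (use p LpD(1)[OF h] abs_Im_le_cmod[of "T f _"] in auto)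
  \<comment> \<open>\<open>R\<close> is complex linear, so it acts on the real and the imaginary part separately\<close>
  have split: "(\<lambda>x. - T f x) = (\<lambda>x. ?a x + \<i> * ?b x)"
    by (auto simp: complex_eq_iff)
  have "AE x in M. R (\<lambda>x. - T f x) x = R ?a x + R (\<lambda>x. \<i> * ?b x) x"
    unfolding split by (intro positive_opD(5)[OF R] Lp_cmult a b)
  moreover have "AE x in M. R (\<lambda>x. \<i> * ?b x) x = \<i> * R ?b x"
    by (rule positive_opD(6)[OF R b])
  moreover have "AE x in M. Im (R ?a x) = 0"
    by (rule positive_op_real[OF R p a]) simp
  moreover have "AE x in M. Im (R ?b x) = 0"
    by (rule positive_op_real[OF R p b]) simp
  ultimately have "AE x in M. R ?b x = 0"
    using res(3)[OF f(1)] f(2) by eventually_elim (simp add: complex_eq_iff)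
  moreover have D0: "(\<lambda>x. 0) \<in> D"
    using T by (simp add: linear_op_def)
  ultimately have "AE x in M. T (R ?b) x = T (\<lambda>x. 0) x"
    using T res(1)[OF b] by (simp add: linear_op_def ae_eq_def)
  moreover have "AE x in M. T (\<lambda>x. 0) x = 0"
  proof -
    have "\<forall>c. \<forall>f\<in>D. ae_eq M (T (\<lambda>x. c * f x)) (\<lambda>x. c * T f x)"
      using T by (simp add: linear_op_def)
    from bspec[OF spec[OF this, of 0] D0] show ?thesis
      by (simp add: ae_eq_def)
  qed
  ultimately show ?thesis
    using res(2)[OF b] by eventually_elim simp
qed

section \<open>Positivity of the critical flux\<close>

text \<open>
  From \<open>c A f \<le> f\<close> follows \<open>c\<^sup>n A\<^sup>n f \<le> f\<close>, so every \<open>A\<^sup>n f\<close> vanishes where \<open>f\<close> does. If that set had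
  positive measure, a weight supported on it would be a nonzero test function annihilating all
  \<open>A\<^sup>n f\<close>.
\<close>

lemma irreducible_supersolution_pos:
  assumes "sigma_finite_measure M" and p: "1 \<le> p"
    and A: "positive_op M p A" "irreducible_op M p A"
    and f: "f \<in> Lp M p" "nonneg M f" "\<not> ae_eq M f (\<lambda>x. 0)"
    and c: "0 < c" "AE x in M. complex_of_real c * A f x \<le> f x"
  shows "f \<in> Lp_pos M p"
proof (rule ccontr)
  assume "f \<notin> Lp_pos M p"
  interpret sigma_finite_measure M by fact
  have p0: "0 \<le> p" using p by simp
  note D = positive_opD[OF positive_op_funpow[OF A(1) p]]
  have f0: "AE x in M. 0 \<le> f x"
    using f(2) by (simp add: nonneg_def)
  have pow: "AE x in M. complex_of_real (c ^ n) * (A ^^ n) f x \<le> f x" for n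
  proof (induction n)
    case (Suc n)
    have "AE x in M. (A ^^ n) (\<lambda>x. complex_of_real c * A f x) x \<le> (A ^^ n) f x"
      by (rule positive_op_mono[OF positive_op_funpow[OF A(1) p] p0 _ f(1) c(2)])
         (intro Lp_cmult positive_opD(2)[OF A(1)] f)
    moreover have "AE x in M. (A ^^ n) (\<lambda>x. complex_of_real c * A f x) x
        = complex_of_real c * (A ^^ n) (A f) x"
      by (intro D(6) positive_opD(2)[OF A(1)] f)
    ultimately show ?case
      using Suc
    proof eventually_elim
      case (elim x)
      have "complex_of_real (c ^ n) * (complex_of_real c * (A ^^ n) (A f) x)
          \<le> complex_of_real (c ^ n) * (A ^^ n) f x"
        using elim(1) c(1) unfolding elim(2)
        by (intro mult_left_mono) (auto simp: less_eq_complex_def simp flip: of_real_power)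
      with elim(3) show ?case
        unfolding funpow_Suc_right o_def by (simp add: mult.assoc mult.left_commute)
    qed
  qed simp
  obtain w :: "'a \<Rightarrow> real" where w: "integrable M w" "\<And>x. x \<in> space M \<Longrightarrow> 0 < w x" "\<And>x. w x \<le> 1"
    using Ex_positive_weight by blast
  \<comment> \<open>a test function living exactly on the zero set of \<open>f\<close>\<close>
  define g where "g = (\<lambda>x. if f x = 0 then complex_of_real (w x) else 0)"
  note [measurable] = LpD(1)[OF f(1)] borel_measurable_integrable[OF w(1)]
  have gm: "g \<in> borel_measurable M"
    unfolding g_def by measurable
  have gw: "AE x in M. norm (g x) \<le> norm (complex_of_real (w x))"
    by (simp add: g_def)
  have "g \<in> dual_Lp M p"
  proof (cases "p = 1")
    case True
    have "norm (g x) \<le> 1" if "x \<in> space M" for x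
      using w(2)[OF that] w(3)[of x] by (simp add: g_def)
    then have "AE x in M. ereal (norm (g x)) \<le> 1"
      by (intro AE_I2) simp
    then have "esssup M (\<lambda>x. ereal (norm (g x))) \<le> 1"
      using gm by (intro esssup_I) auto
    then have "esssup M (\<lambda>x. ereal (norm (g x))) < \<infinity>"
      by (rule order_le_less_trans) simp
    with True gm show ?thesis
      by (simp add: dual_Lp_def Linf_def)
  next
    case False
    then have "1 \<le> p / (p - 1)"
      using p by (simp add: field_simps)
    with False show ?thesis
      using Lp_dominated[OF Lp_weight[OF w, of "p / (p - 1)"] gm gw] by (simp add: dual_Lp_def)
  qed
  moreover have "nonneg M g"
    unfolding nonneg_def g_def using w(2) by (intro AE_I2) (simp add: less_eq_complex_def less_imp_le)
  moreover have "\<not> ae_eq M g (\<lambda>x. 0)"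
  proof
    assume "ae_eq M g (\<lambda>x. 0)"
    then have "AE x in M. 0 < f x"
      using f0 AE_space unfolding ae_eq_def
    proof eventually_elim
      case (elim x)
      then have "f x \<noteq> 0"
        using w(2)[of x] by (auto simp: g_def)
      with elim show ?case by simp
    qed
    with f(1) \<open>f \<notin> Lp_pos M p\<close> show False
      by (simp add: Lp_pos_def)
  qed
  ultimately obtain n where n: "0 < pairing M ((A ^^ n) f) g"
    using A(2) f unfolding irreducible_op_def by blast
  have "AE x in M. (A ^^ n) f x * g x = 0"
    using pow[of n] D(3)[OF f(1) f0, of n]
  proof eventually_elim
    case (elim x)
    have "(A ^^ n) f x = 0" if "f x = 0"
    proof -
      have "0 \<le> complex_of_real (c ^ n) * (A ^^ n) f x"
        using elim(2) c(1) by (auto simp: less_eq_complex_def simp flip: of_real_power)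
      with elim(1) that c(1) show ?thesis by simp
    qed
    then show ?case by (simp add: g_def)
  qed
  then have "pairing M ((A ^^ n) f) g = 0"
    unfolding pairing_def by (rule integral_eq_zero_AE)
  with n show False by simp
qed

section \<open>Comparison of sub- and supersolutions\<close>

lemma funpow_dominated:
  assumes A: "positive_op M p A" and B: "positive_op M p B" and p: "1 \<le> p" and c: "0 \<le> c"
    and dom: "\<And>v. v \<in> Lp M p \<Longrightarrow> nonneg M v \<Longrightarrow> AE x in M. B v x \<le> complex_of_real c * A v x"
    and v: "v \<in> Lp M p" "nonneg M v"
  shows "AE x in M. (B ^^ n) v x \<le> complex_of_real (c ^ n) * (A ^^ n) v x"
proof (induction n)
  case (Suc n)
  have p0: "0 \<le> p" using p by simp
  note DA = positive_opD[OF positive_op_funpow[OF A p]]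
  have v0: "AE x in M. 0 \<le> v x"
    using v(2) by (simp add: nonneg_def)
  have Bv: "(B ^^ n) v \<in> Lp M p" "nonneg M ((B ^^ n) v)"
    using positive_opD(2,3)[OF positive_op_funpow[OF B p] v(1)] v0 by (auto simp: nonneg_def)
  have cA: "(\<lambda>x. complex_of_real (c ^ n) * (A ^^ n) v x) \<in> Lp M p"
    by (intro Lp_cmult DA v)
  have "AE x in M. B ((B ^^ n) v) x \<le> complex_of_real c * A ((B ^^ n) v) x"
    by (rule dom[OF Bv])
  moreover have "AE x in M. A ((B ^^ n) v) x \<le> A (\<lambda>x. complex_of_real (c ^ n) * (A ^^ n) v x) x"
    by (rule positive_op_mono[OF A p0 Bv(1) cA Suc])
  moreover have "AE x in M. A (\<lambda>x. complex_of_real (c ^ n) * (A ^^ n) v x) x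
      = complex_of_real (c ^ n) * A ((A ^^ n) v) x"
    by (intro positive_opD(6)[OF A] DA v)
  ultimately show ?case
  proof eventually_elim
    case (elim x)
    have "complex_of_real c * A ((B ^^ n) v) x
        \<le> complex_of_real c * (complex_of_real (c ^ n) * A ((A ^^ n) v) x)"
      using elim(2) c unfolding elim(3)
      by (intro mult_left_mono) (auto simp: less_eq_complex_def)
    with elim(1) show ?case
      by (simp add: mult.assoc)
  qed
qed simp

text \<open>
  The heart of the matter: \<open>\<mu> < \<nu>\<close> would make the subsolution for \<open>B\<^sub>\<mu>\<close> a strict subsolution for \<open>B\<^sub>\<nu>\<close>,
  with the gap \<open>(\<nu> - \<mu>) R Kf f\<close>, which is strictly positive because \<open>R\<close> and \<open>Kf\<close> preserve strict
  positivity. On nonnegative functions \<open>B\<^sub>\<nu>\<close> is at most \<open>max 1 \<nu>\<close> times \<open>R (Ks + Kf)\<close>, which supplies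
  the compact majorant.
\<close>

lemma sub_super_comparison:
  assumes p: "1 \<le> p"
    and R: "positive_op M p R" and Ks: "positive_op M p Ks" and Kf: "positive_op M p Kf"
    and compact: "power_compact M p (\<lambda>f. R (\<lambda>x. Ks f x + Kf f x))"
    and pos: "R ` Lp_pos M p \<subseteq> Lp_pos M p" "Kf ` Lp_pos M p \<subseteq> Lp_pos M p"
    and g: "g \<in> Lp_pos M p" "0 \<le> \<nu>"
      "AE x in M. R (\<lambda>x. Ks g x + complex_of_real \<nu> * Kf g x) x \<le> g x"
    and f: "f \<in> Lp_pos M p" "\<not> ae_eq M f (\<lambda>x. 0)"
      "AE x in M. f x \<le> R (\<lambda>x. Ks f x + complex_of_real \<mu> * Kf f x) x"
  shows "\<nu> \<le> \<mu>"
proof (rule ccontr)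
  assume "\<not> \<nu> \<le> \<mu>"
  have p0: "0 \<le> p" using p by simp
  define B where "B = (\<lambda>f. R (\<lambda>x. Ks f x + complex_of_real \<nu> * Kf f x))"
  define A where "A = (\<lambda>f. R (\<lambda>x. Ks f x + complex_of_real 1 * Kf f x))"
  have B: "positive_op M p B"
    unfolding B_def by (intro positive_op_comp[OF R] positive_op_add_cmult Ks Kf p g(2))
  have A: "positive_op M p A"
    unfolding A_def by (intro positive_op_comp[OF R] positive_op_add_cmult Ks Kf p) simp
  obtain n where n: "1 \<le> n" "compact_op M p (A ^^ n)"
    using compact by (auto simp: power_compact_def A_def)
  define c where "c = max 1 \<nu>"
  have c: "0 < c" by (simp add: c_def)
  have dom: "AE x in M. B v x \<le> complex_of_real c * A v x" if v: "v \<in> Lp M p" "nonneg M v" for v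
  proof -
    have v0: "AE x in M. 0 \<le> v x"
      using v(2) by (simp add: nonneg_def)
    have L: "Ks v \<in> Lp M p" "Kf v \<in> Lp M p"
      using positive_opD(2)[OF Ks] positive_opD(2)[OF Kf] v(1) by auto
    have sum: "(\<lambda>x. Ks v x + complex_of_real 1 * Kf v x) \<in> Lp M p"
      by (intro Lp_add Lp_cmult L p0)
    have "AE x in M. Ks v x + complex_of_real \<nu> * Kf v x
        \<le> complex_of_real c * (Ks v x + complex_of_real 1 * Kf v x)"
      using positive_opD(3)[OF Ks v(1) v0] positive_opD(3)[OF Kf v(1) v0]
    proof eventually_elim
      case (elim x)
      have "1 * Re (Ks v x) \<le> c * Re (Ks v x)" "\<nu> * Re (Kf v x) \<le> c * Re (Kf v x)"
        using elim unfolding c_def less_eq_complex_def by (intro mult_right_mono; simp)+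
      with elim show ?case
        by (simp add: less_eq_complex_def algebra_simps)
    qed
    then have "AE x in M. B v x \<le> R (\<lambda>x. complex_of_real c * (Ks v x + complex_of_real 1 * Kf v x)) x"
      unfolding B_def by (intro positive_op_mono[OF R p0] Lp_add Lp_cmult L p0)
    with positive_opD(6)[OF R sum, of "complex_of_real c"] show ?thesis
      unfolding A_def by eventually_elim simp
  qed
  have fL: "f \<in> Lp M p" and f0: "nonneg M f"
    using f(1) by (auto simp: Lp_pos_def nonneg_def elim: eventually_mono)
  have L: "Ks f \<in> Lp M p" "Kf f \<in> Lp M p"
    using positive_opD(2)[OF Ks] positive_opD(2)[OF Kf] fL by auto
  define d where "d = \<nu> - \<mu>"
  have d: "0 < d" using \<open>\<not> \<nu> \<le> \<mu>\<close> by (simp add: d_def)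
  define e where "e = (\<lambda>x. complex_of_real d * R (Kf f) x)"
  have RKf: "R (Kf f) \<in> Lp_pos M p"
    using pos f(1) by blast
  then have e: "e \<in> Lp_pos M p"
    using d unfolding e_def Lp_pos_def
    by (auto simp: less_complex_def intro!: Lp_cmult elim!: eventually_mono)
  have lin: "AE x in M. R (\<lambda>x. Ks f x + complex_of_real t * Kf f x) x
      = R (Ks f) x + complex_of_real t * R (Kf f) x" for t
    using positive_opD(5)[OF R L(1) Lp_cmult[OF L(2)], of "complex_of_real t"]
      positive_opD(6)[OF R L(2), of "complex_of_real t"]
    by eventually_elim simp
  have fe: "AE x in M. f x + e x \<le> B f x"
    using f(3) lin[of \<mu>] lin[of \<nu>]
  proof eventually_elim
    case (elim x)
    have "f x + e x \<le> R (Ks f) x + complex_of_real \<mu> * R (Kf f) x + e x"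
      using elim(1) unfolding elim(2) by (rule add_right_mono)
    also have "\<dots> = B f x"
      unfolding B_def elim(3) by (simp add: e_def d_def algebra_simps)
    finally show ?case .
  qed
  have "ae_eq M f (\<lambda>x. 0)"
  proof (rule no_strict_subsolution[OF B p n(2) _ n(1) _ g(1) _ fL f0 e fe])
    show "0 < c ^ n" using c by simp
    show "AE x in M. (B ^^ n) v x \<le> complex_of_real (c ^ n) * (A ^^ n) v x"
      if "v \<in> Lp M p" "nonneg M v" for v
      by (rule funpow_dominated[OF A B p _ dom that]) (use c in auto)
    show "AE x in M. B g x \<le> g x"
      using g(3) by (simp add: B_def)
  qed
  with f(2) show False ..
qed

section \<open>The criticality quotient\<close>

text \<open>
  Passes between the quotient and the inequality that \<open>R\<close> can be applied to: with \<open>t\<close>, \<open>s\<close>, \<open>k\<close> the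
  values of \<open>T f\<close>, \<open>Ks f\<close>, \<open>Kf f\<close> at a point, all of them are real, and the positive denominator can
  be multiplied away.
\<close>

lemma quotient_pointwise:
  assumes "0 < k" "0 \<le> s" "Im t = 0"
  shows "Re (- (t + s) / k) \<le> \<mu> \<longleftrightarrow> - t \<le> s + complex_of_real \<mu> * k"
    and "\<mu> \<le> Re (- (t + s) / k) \<longleftrightarrow> s + complex_of_real \<mu> * k \<le> - t"
proof -
  define \<kappa> \<sigma> \<tau> where "\<kappa> = Re k" "\<sigma> = Re s" "\<tau> = Re t"
  have *: "k = complex_of_real \<kappa>" "s = complex_of_real \<sigma>" "t = complex_of_real \<tau>" "0 < \<kappa>"
    using assms by (auto simp: \<kappa>_\<sigma>_\<tau>_def complex_eq_iff less_complex_def less_eq_complex_def)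
  have q: "Re (- (t + s) / k) = - (\<tau> + \<sigma>) / \<kappa>"
    unfolding * of_real_add[symmetric] of_real_minus[symmetric] of_real_divide[symmetric] by simp
  have "- (\<tau> + \<sigma>) / \<kappa> \<le> \<mu> \<longleftrightarrow> - \<tau> \<le> \<sigma> + \<mu> * \<kappa>" "\<mu> \<le> - (\<tau> + \<sigma>) / \<kappa> \<longleftrightarrow> \<sigma> + \<mu> * \<kappa> \<le> - \<tau>"
    using *(4) by (auto simp: pos_divide_le_eq pos_le_divide_eq)
  then show "Re (- (t + s) / k) \<le> \<mu> \<longleftrightarrow> - t \<le> s + complex_of_real \<mu> * k"
    and "\<mu> \<le> Re (- (t + s) / k) \<longleftrightarrow> s + complex_of_real \<mu> * k \<le> - t"
    unfolding q by (simp_all add: *(1-3) less_eq_complex_def)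
qed

lemma essinf_AE: "AE x in M. essinf M f \<le> f x"
  using esssup_AE[of "\<lambda>x. - f x" M] by eventually_elim (simp add: essinf_def ereal_uminus_le_reorder)

section \<open>Characterization of the criticality eigenvalue\<close>

theorem theorem2p15:
  fixes M :: "'a measure" and p :: real and D :: "('a \<Rightarrow> complex) set"
    and T Ks Kf :: "('a \<Rightarrow> complex) \<Rightarrow> ('a \<Rightarrow> complex)"
    and L :: ennreal and k_eff :: real
  assumes sigma_finite: "sigma_finite_measure M"
    and p: "1 \<le> p"
    and T: "linear_op M p D T" "densely_defined M p D"
    and T_bound: "spectral_bound M p D T < 0"
    and T_pos: "resolvent M p D T 0 ` Lp_pos M p \<subseteq> Lp_pos M p"
    and Ks: "bounded_op M p Ks" "nonneg_op M p Ks"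
    and Kf: "bounded_op M p Kf" "nonneg_op M p Kf"
    and compact: "power_compact M p (\<lambda>f. resolvent M p D T 0 (\<lambda>x. Ks f x + Kf f x))"
    and irreducible: "irreducible_op M p (\<lambda>f. resolvent M p D T 0 (Kf f))"
    and lim: "((\<lambda>\<gamma>. spectral_radius M p (\<lambda>f. resolvent M p D T 0 (K_gamma Ks Kf \<gamma> f)))
                \<longlongrightarrow> L) (at_right 0)" "1 < L"
    and subcritical: "spectral_radius M p (\<lambda>f. resolvent M p D T 0 (Ks f)) < 1"
    and Kf_pos: "Kf ` Lp_pos M p \<subseteq> Lp_pos M p"
    and k_eff: "criticality_eigenvalue M D T Ks Kf k_eff"
  shows "is_min_over (D \<inter> Lp_pos M p) (\<lambda>\<phi>. esssup M (criticality_quotient T Ks Kf \<phi>)) (ereal (1 / k_eff))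
       \<and> is_max_over (D \<inter> Lp_pos M p) (\<lambda>\<phi>. essinf M (criticality_quotient T Ks Kf \<phi>)) (ereal (1 / k_eff))"
proof -
  have p0: "0 \<le> p" using p by simp
  define R where "R = resolvent M p D T 0"
  have isR: "is_resolvent M p D T 0 R"
    unfolding R_def by (rule is_resolvent_0[OF T_bound])
  note res = is_resolvent_0D[OF isR]
  have R_pos: "R ` Lp_pos M p \<subseteq> Lp_pos M p"
    using T_pos by (simp add: R_def)
  have bR: "bounded_op M p R"
    using isR by (simp add: is_resolvent_def)
  have R: "positive_op M p R"
    unfolding positive_op_def using bR nonneg_op_if_strictly_positive[OF sigma_finite p bR R_pos] by simp
  have Ks': "positive_op M p Ks" and Kf': "positive_op M p Kf"
    using Ks Kf by (auto simp: positive_op_def)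
  have compact': "power_compact M p (\<lambda>f. R (\<lambda>x. Ks f x + Kf f x))"
    using compact by (simp add: R_def)
  have DL: "f \<in> Lp M p" and TL: "T f \<in> Lp M p" if "f \<in> D" for f
    using T(1) that by (auto simp: linear_op_def)
  have KL: "Ks f \<in> Lp M p" "Kf f \<in> Lp M p" if "f \<in> Lp M p" for f
    using positive_opD(2)[OF Ks'] positive_opD(2)[OF Kf'] that by auto
  have TL': "(\<lambda>x. - T f x) \<in> Lp M p" if "f \<in> D" for f
    using Lp_cmult[OF TL[OF that], of "-1"] by simp
  have SL: "(\<lambda>x. Ks f x + complex_of_real \<mu> * Kf f x) \<in> Lp M p" if "f \<in> D" for f \<mu>
    by (intro Lp_add Lp_cmult KL DL that p0)

  define \<rho> where "\<rho> = 1 / k_eff"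
  obtain \<phi> where \<phi>: "\<phi> \<in> D" "nonneg M \<phi>" "\<not> ae_eq M \<phi> (\<lambda>x. 0)"
    "AE x in M. T \<phi> x + Ks \<phi> x + complex_of_real \<rho> * Kf \<phi> x = 0" and \<rho>: "0 < \<rho>"
    using k_eff unfolding criticality_eigenvalue_def ae_eq_def \<rho>_def by auto
  have \<phi>L: "\<phi> \<in> Lp M p" by (rule DL[OF \<phi>(1)])
  have \<phi>0: "AE x in M. 0 \<le> \<phi> x"
    using \<phi>(2) by (simp add: nonneg_def)
  have "AE x in M. - T \<phi> x = Ks \<phi> x + complex_of_real \<rho> * Kf \<phi> x"
    using \<phi>(4) by eventually_elim (simp add: add_eq_0_iff add.assoc)
  then have "AE x in M. R (\<lambda>x. - T \<phi> x) x = R (\<lambda>x. Ks \<phi> x + complex_of_real \<rho> * Kf \<phi> x) x"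
    by (intro positive_opD(4)[OF R] TL' SL \<phi>)
  then have eigen: "AE x in M. R (\<lambda>x. Ks \<phi> x + complex_of_real \<rho> * Kf \<phi> x) x = \<phi> x"
    using res(3)[OF \<phi>(1)] by eventually_elim simp
  \<comment> \<open>dropping the scattering term from the eigenvalue equation leaves \<open>\<rho> R Kf \<phi> \<le> \<phi>\<close>, to which irreducibility applies\<close>
  have \<phi>_pos: "\<phi> \<in> Lp_pos M p"
  proof (rule irreducible_supersolution_pos[OF sigma_finite p _ _ \<phi>L \<phi>(2,3) \<rho>])
    show "positive_op M p (\<lambda>f. R (Kf f))"
      by (rule positive_op_comp[OF R Kf' p])
    show "irreducible_op M p (\<lambda>f. R (Kf f))"
      using irreducible by (simp add: R_def)
    have "AE x in M. R (\<lambda>x. complex_of_real \<rho> * Kf \<phi> x) x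
        \<le> R (\<lambda>x. Ks \<phi> x + complex_of_real \<rho> * Kf \<phi> x) x"
      using positive_opD(3)[OF Ks' \<phi>L \<phi>0]
      by (intro positive_op_mono[OF R p0] SL \<phi> Lp_cmult KL \<phi>L) (auto elim: eventually_mono)
    then show "AE x in M. complex_of_real \<rho> * R (Kf \<phi>) x \<le> \<phi> x"
      using eigen positive_opD(6)[OF R KL(2)[OF \<phi>L], of "complex_of_real \<rho>"]
      by eventually_elim simp
  qed

  have signs: "AE x in M. 0 < Kf f x \<and> 0 \<le> Ks f x \<and> Im (T f x) = 0"
    if f: "f \<in> D" "f \<in> Lp_pos M p" for f
  proof -
    have f0: "AE x in M. 0 < f x" using f by (simp add: Lp_pos_def)
    have "AE x in M. 0 < Kf f x" using f(2) Kf_pos unfolding Lp_pos_def by blast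
    moreover have "AE x in M. 0 \<le> Ks f x"
      using f0 by (intro positive_opD(3)[OF Ks'] DL f) (auto elim: eventually_mono)
    moreover have "AE x in M. Im (T f x) = 0"
      using f0 by (intro generator_real[OF T(1) isR R p0] f) (auto simp: less_complex_def elim: eventually_mono)
    ultimately show ?thesis by eventually_elim simp
  qed
  have sub: "AE x in M. f x \<le> R (\<lambda>x. Ks f x + complex_of_real \<mu> * Kf f x) x"
    if f: "f \<in> D" "f \<in> Lp_pos M p" and q: "esssup M (criticality_quotient T Ks Kf f) \<le> ereal \<mu>" for f \<mu>
  proof -
    have "AE x in M. - T f x \<le> Ks f x + complex_of_real \<mu> * Kf f x"
      using esssup_AE[of "criticality_quotient T Ks Kf f" M] signs[OF f]
    proof eventually_elim
      case (elim x)
      from order_trans[OF elim(1) q] have "Re (- (T f x + Ks f x) / Kf f x) \<le> \<mu>"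
        by (simp add: criticality_quotient_def)
      with elim(2) show ?case using quotient_pointwise(1) by blast
    qed
    then have "AE x in M. R (\<lambda>x. - T f x) x \<le> R (\<lambda>x. Ks f x + complex_of_real \<mu> * Kf f x) x"
      by (intro positive_op_mono[OF R p0] TL' SL f)
    with res(3)[OF f(1)] show ?thesis by eventually_elim simp
  qed
  have super: "AE x in M. R (\<lambda>x. Ks f x + complex_of_real \<mu> * Kf f x) x \<le> f x"
    if f: "f \<in> D" "f \<in> Lp_pos M p" and q: "ereal \<mu> \<le> essinf M (criticality_quotient T Ks Kf f)" for f \<mu>
  proof -
    have "AE x in M. Ks f x + complex_of_real \<mu> * Kf f x \<le> - T f x"
      using essinf_AE[of M "criticality_quotient T Ks Kf f"] signs[OF f]
    proof eventually_elim
      case (elim x)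
      from order_trans[OF q elim(1)] have "\<mu> \<le> Re (- (T f x + Ks f x) / Kf f x)"
        by (simp add: criticality_quotient_def)
      with elim(2) show ?case using quotient_pointwise(2) by blast
    qed
    then have "AE x in M. R (\<lambda>x. Ks f x + complex_of_real \<mu> * Kf f x) x \<le> R (\<lambda>x. - T f x) x"
      by (intro positive_op_mono[OF R p0] TL' SL f)
    with res(3)[OF f(1)] show ?thesis by eventually_elim simp
  qed
  \<comment> \<open>on a null space an essential supremum would be \<open>- \<infinity>\<close>, even for a constant\<close>
  have nontrivial: "emeasure M (space M) \<noteq> 0"
  proof
    assume "emeasure M (space M) = 0"
    then have "AE x in M. False"
      using ae_filter_eq_bot_iff[of M] trivial_limit_def[of "ae_filter M"] by simp
    then have "ae_eq M \<phi> (\<lambda>x. 0)"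
      unfolding ae_eq_def by (rule eventually_mono) simp
    with \<phi>(3) show False ..
  qed
  have nonzero: "\<not> ae_eq M f (\<lambda>x. 0)" if "f \<in> Lp_pos M p" for f
  proof
    assume "ae_eq M f (\<lambda>x. 0)"
    moreover have "AE x in M. 0 < f x"
      using that by (simp add: Lp_pos_def)
    ultimately have "AE x in M. False"
      unfolding ae_eq_def by eventually_elim simp
    then show False
      using nontrivial ae_filter_eq_bot_iff[of M] by (simp add: trivial_limit_def)
  qed
  note compare = sub_super_comparison[OF p R Ks' Kf' compact' R_pos Kf_pos]

  have qm: "criticality_quotient T Ks Kf \<phi> \<in> borel_measurable M"
    using LpD(1)[OF TL[OF \<phi>(1)]] LpD(1)[OF KL(1)[OF \<phi>L]] LpD(1)[OF KL(2)[OF \<phi>L]]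
    unfolding criticality_quotient_def by measurable
  have q\<phi>: "AE x in M. criticality_quotient T Ks Kf \<phi> x = ereal \<rho>"
    using \<phi>(4) signs[OF \<phi>(1) \<phi>_pos]
  proof eventually_elim
    case (elim x)
    then have "- (T \<phi> x + Ks \<phi> x) / Kf \<phi> x = complex_of_real \<rho>"
      by (auto simp: field_simps add_eq_0_iff)
    then show ?case by (simp add: criticality_quotient_def)
  qed
  have sup\<phi>: "esssup M (criticality_quotient T Ks Kf \<phi>) = ereal \<rho>"
    using esssup_AE_cong[OF qm _ q\<phi>] esssup_const[OF nontrivial] by simp
  have "esssup M (\<lambda>x. - criticality_quotient T Ks Kf \<phi> x) = esssup M (\<lambda>x. - ereal \<rho>)"
    using q\<phi> qm by (intro esssup_AE_cong) (auto elim: eventually_mono)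
  then have inf\<phi>: "essinf M (criticality_quotient T Ks Kf \<phi>) = ereal \<rho>"
    using esssup_const[OF nontrivial, of "- ereal \<rho>"] by (simp add: essinf_def)

  have lower: "ereal \<rho> \<le> esssup M (criticality_quotient T Ks Kf f)" if f: "f \<in> D" "f \<in> Lp_pos M p" for f
  proof (rule ccontr)
    assume "\<not> ?thesis"
    \<comment> \<open>a real level strictly in between, as the essential supremum may be \<open>- \<infinity>\<close>\<close>
    then obtain \<mu> where \<mu>: "esssup M (criticality_quotient T Ks Kf f) < ereal \<mu>" "ereal \<mu> < ereal \<rho>"
      using ereal_dense2 by (meson not_le)
    have "\<rho> \<le> \<mu>"
      by (rule compare[OF \<phi>_pos _ _ f(2) nonzero[OF f(2)] sub[OF f less_imp_le[OF \<mu>(1)]]])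
         (use \<rho> eigen in \<open>auto elim: eventually_mono\<close>)
    with \<mu>(2) show False by simp
  qed
  have upper: "essinf M (criticality_quotient T Ks Kf f) \<le> ereal \<rho>" if f: "f \<in> D" "f \<in> Lp_pos M p" for f
  proof (rule ccontr)
    assume "\<not> ?thesis"
    \<comment> \<open>a real level strictly in between, as the essential infimum may be \<open>\<infinity>\<close>\<close>
    then obtain \<mu> where \<mu>: "ereal \<rho> < ereal \<mu>" "ereal \<mu> < essinf M (criticality_quotient T Ks Kf f)"
      using ereal_dense2 by (meson not_le)
    have "\<mu> \<le> \<rho>"
      by (rule compare[OF f(2) _ super[OF f less_imp_le[OF \<mu>(2)]] \<phi>_pos \<phi>(3)])
         (use \<rho> \<mu>(1) eigen in \<open>auto elim: eventually_mono\<close>)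
    with \<mu>(1) show False by simp
  qed
  have "\<phi> \<in> D \<inter> Lp_pos M p" using \<phi>(1) \<phi>_pos by simp
  then show ?thesis
    unfolding is_min_over_def is_max_over_def \<rho>_def[symmetric]
    using lower upper sup\<phi> inf\<phi> by (auto intro!: image_eqI[of _ _ \<phi>])
qed

end
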